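(* Let $n\ge 1$ be an integer and let $\mathcal{E}\subseteq\mathcal{P}$ be any nonempty set of errors in the Pauli group $\mathcal{P}$ on $n$ qubits. Then there exist an integer $k\ge 0$ and a two-way entanglement purification protocol (2-EPP) producing $k$ EPR pairs from $n$ EPR pairs and correcting $\mathcal{E}$, such that $$k \ \geq\ n - \log_2 |\mathcal{E}| - 2 .$$
   Context: The Pauli group $\mathcal{P}$ on $n$ qubits consists of all $n$-fold tensor products of the matrices $I$, $X=\begin{pmatrix}0&1\\1&0\end{pmatrix}$, $Y=\begin{pmatrix}0&-i\\i&0\end{pmatrix}$, $Z=\begin{pmatrix}1&0\\0&-1\end{pmatrix}$, with overall phase $\pm1,\pm i$. An EPR pair is a two-qubit state $\frac{1}{\sqrt2}(|00\rangle+|11\rangle)$, with the first qubit held by Alice and the second by Bob. In an entanglement purification protocol on $n$ pairs, Alice prepares $n$ EPR pairs and sends the second half of each to Bob through a noisy quantum channel, which acts on the $n$ transmitted qubits. Alice and Bob then process their qubits by local quantum operations (including measurements) and communication over noiseless classical channels. The protocol is a two-way protocol (2-EPP) if classical communication is allowed in both directions, so that each local operation may depend on all measurement results communicated so far. At the end the parties output $k$ pairs of qubits (one qubit of each pair with Alice, one with Bob). A 2-EPP producing $k$ pairs from $n$ pairs corrects a set $\mathcal{E}\subseteq\mathcal{P}$ if, for every $P\in\mathcal{E}$, when the channel applies $P$ to Bob's $n$ qubits, the protocol always (with probability 1) outputs $k$ pairs that are exactly (fidelity 1) in the state of $k$ perfect EPR pairs. The protocol may depend on $\mathcal{E}$ but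 not on which $P\in\mathcal{E}$ occurs. The case $k=0$ is trivially achievable. *)

theory Defs
  imports "Jordan_Normal_Form.Schur_Decomposition"
begin

section \<open>Matrices\<close>

definition kron :: "complex mat \<Rightarrow> complex mat \<Rightarrow> complex mat" where
  "kron A B = mat (dim_row A * dim_row B) (dim_col A * dim_col B)
     (\<lambda>(i, j). A $$ (i div dim_row B, j div dim_col B) * B $$ (i mod dim_row B, j mod dim_col B))"

definition trace_mat :: "complex mat \<Rightarrow> complex" where
  "trace_mat A = (\<Sum>i<dim_row A. A $$ (i, i))"

definition sum_mats :: "nat \<Rightarrow> nat \<Rightarrow> complex mat list \<Rightarrow> complex mat" where
  "sum_mats r c As = foldr (+) As (0\<^sub>m r c)"

definition pure_state :: "complex vec \<Rightarrow> complex mat" where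
  "pure_state v = mat (dim_vec v) (dim_vec v) (\<lambda>(i, j). v $ i * conjugate (v $ j))"

definition sandwich :: "complex mat \<Rightarrow> complex mat \<Rightarrow> complex mat" where
  "sandwich K \<rho> = K * \<rho> * mat_adjoint K"


section \<open>The Pauli group\<close>

definition pauli_X :: "complex mat" where
  "pauli_X = mat_of_rows_list 2 [[0, 1], [1, 0]]"

definition pauli_Y :: "complex mat" where
  "pauli_Y = mat_of_rows_list 2 [[0, - \<i>], [\<i>, 0]]"

definition pauli_Z :: "complex mat" where
  "pauli_Z = mat_of_rows_list 2 [[1, 0], [0, - 1]]"

definition tensor_list :: "complex mat list \<Rightarrow> complex mat" where
  "tensor_list As = foldr kron As (1\<^sub>m 1)"

text \<open>The phase is part of a group element, so the group has \<open>4 ^ (n + 1)\<close> elements.\<close>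

definition pauli_group :: "nat \<Rightarrow> complex mat set" where
  "pauli_group n = {c \<cdot>\<^sub>m tensor_list Ps | c Ps.
     c \<in> {1, - 1, \<i>, - \<i>} \<and> length Ps = n \<and> set Ps \<subseteq> {1\<^sub>m 2, pauli_X, pauli_Y, pauli_Z}}"

lemma finite_pauli_group: "finite (pauli_group n)"
proof -
  have "pauli_group n = (\<lambda>(c, Ps). c \<cdot>\<^sub>m tensor_list Ps) `
     ({1, - 1, \<i>, - \<i>} \<times> {Ps. set Ps \<subseteq> {1\<^sub>m 2, pauli_X, pauli_Y, pauli_Z} \<and> length Ps = n})"
    unfolding pauli_group_def by (force simp: image_iff)
  then show ?thesis
    by (simp add: finite_lists_length_eq)
qed


section \<open>EPR pairs\<close>

text \<open>
  A joint state of Alice (dimension \<open>a\<close>) and Bob (dimension \<open>b\<close>) lives on a space of dimension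
  \<open>a * b\<close>; the basis vector \<open>|x>|y>\<close> has index \<open>x * b + y\<close>, in agreement with \<^const>\<open>kron\<close>.
\<close>

definition epr_pair :: "complex vec" where
  "epr_pair = vec_of_list [1 / sqrt 2, 0, 0, 1 / sqrt 2]"

text \<open>
  The tensor power of \<open>k\<close> EPR pairs, with the factors reordered such that the \<open>k\<close> qubits of Alice
  precede the \<open>k\<close> qubits of Bob: the \<open>j\<close>-th pair consists of binary digit \<open>j\<close> of Alice's index
  and binary digit \<open>j\<close> of Bob's index.
\<close>

definition epr_pairs :: "nat \<Rightarrow> complex vec" where
  "epr_pairs k = vec (2 ^ k * 2 ^ k) (\<lambda>i. let x = i div 2 ^ k; y = i mod 2 ^ k in
     \<Prod>j<k. epr_pair $ (2 * of_bool (bit x j) + of_bool (bit y j)))"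

lemma epr_pairs_index:
  assumes "x < 2 ^ k" "y < 2 ^ k"
  shows "epr_pairs k $ (x * 2 ^ k + y) = (if x = y then 1 / complex_of_real (sqrt 2) ^ k else 0)"
proof -
  have "x * 2 ^ k + y < 2 ^ k * 2 ^ k"
  proof -
    have "(x + 1) * 2 ^ k \<le> 2 ^ k * 2 ^ k"
      using assms(1) by (intro mult_right_mono) auto
    then show ?thesis using assms(2) by simp
  qed
  then have *: "epr_pairs k $ (x * 2 ^ k + y)
      = (\<Prod>j<k. epr_pair $ (2 * of_bool (bit x j) + of_bool (bit y j)))"
    using assms(2) by (simp add: epr_pairs_def Let_def)
  have entry: "epr_pair $ (2 * of_bool p + of_bool q) = (if p = q then 1 / complex_of_real (sqrt 2) else 0)"
    for p q
    by (cases p; cases q) (simp_all add: epr_pair_def vec_of_list_index numeral_eq_Suc)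
  show ?thesis
  proof (cases "x = y")
    case True
    then show ?thesis
      unfolding * entry by (simp add: power_divide)
  next
    case False
    have "take_bit k x = x" "take_bit k y = y"
      using assms by (simp_all add: take_bit_nat_eq_self)
    with False obtain j where "j < k" "bit x j \<noteq> bit y j"
      by (metis bit_eq_iff bit_take_bit_iff)
    then show ?thesis
      unfolding * entry using False by (auto intro!: prod_zero bexI[of _ j])
  qed
qed


section \<open>Two-way entanglement purification protocols\<close>

text \<open>
  A local operation is a quantum instrument with finitely many outcomes \<open>m < length Ks\<close>, mapping
  dimension \<open>a\<close> to dimension \<open>d\<close>: the list \<open>Ks ! m\<close> consists of the Kraus operators of the
  completely positive map that belongs to outcome \<open>m\<close>. This covers unitaries, adding ancillas
  (\<open>d > a\<close>), discarding subsystems, measurements and local randomness.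
\<close>

definition is_instrument :: "nat \<Rightarrow> nat \<Rightarrow> complex mat list list \<Rightarrow> bool" where
  "is_instrument a d Ks \<longleftrightarrow>
     (\<forall>K \<in> set (concat Ks). K \<in> carrier_mat d a) \<and>
     sum_mats a a (map (\<lambda>K. mat_adjoint K * K) (concat Ks)) = 1\<^sub>m a"

text \<open>
  In \<open>AliceOp d Ks f\<close> Alice applies the instrument \<open>Ks\<close> with output dimension \<open>d\<close> to her system and
  announces the outcome \<open>m\<close>, whereupon the parties continue with \<open>f m\<close>; \<open>BobOp\<close> is analogous.
  Every operation may thus depend on all earlier outcomes of both parties. Information that a
  party does not want to announce can be kept in its quantum system. Only the values of \<open>f\<close> below
  \<open>length Ks\<close> matter, so every protocol consists of finitely many rounds.
\<close>

datatype protocol =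
    Output
  | AliceOp nat "complex mat list list" "nat \<Rightarrow> protocol"
  | BobOp nat "complex mat list list" "nat \<Rightarrow> protocol"

text \<open>
  \<open>locc k \<pi> a b\<close>: the protocol \<open>\<pi>\<close> can be run on systems of dimensions \<open>a\<close> (Alice) and
  \<open>b\<close> (Bob), and in every branch it ends with \<open>k\<close> qubits for each party.
\<close>

primrec locc :: "nat \<Rightarrow> protocol \<Rightarrow> nat \<Rightarrow> nat \<Rightarrow> bool" where
  "locc k Output a b \<longleftrightarrow> a = 2 ^ k \<and> b = 2 ^ k"
| "locc k (AliceOp d Ks f) a b \<longleftrightarrow> is_instrument a d Ks \<and> (\<forall>m<length Ks. locc k (f m) d b)"
| "locc k (BobOp d Ks f) a b \<longleftrightarrow> is_instrument b d Ks \<and> (\<forall>m<length Ks. locc k (f m) a d)"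

definition two_way_epp :: "nat \<Rightarrow> nat \<Rightarrow> protocol \<Rightarrow> bool" where
  "two_way_epp n k \<pi> \<longleftrightarrow> locc k \<pi> (2 ^ n) (2 ^ n)"

text \<open>
  The unnormalised final states of all sequences of outcomes, starting from the density matrix
  \<open>\<rho>\<close>; the trace of a final state is the probability of the outcome sequence.
\<close>

primrec final_states :: "protocol \<Rightarrow> nat \<Rightarrow> nat \<Rightarrow> complex mat \<Rightarrow> complex mat set" where
  "final_states Output a b \<rho> = {\<rho>}"
| "final_states (AliceOp d Ks f) a b \<rho> = (\<Union>m<length Ks.
     final_states (f m) d b
       (sum_mats (d * b) (d * b) (map (\<lambda>K. sandwich (kron K (1\<^sub>m b)) \<rho>) (Ks ! m))))"
| "final_states (BobOp d Ks f) a b \<rho> = (\<Union>m<length Ks.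
     final_states (f m) a d
       (sum_mats (a * d) (a * d) (map (\<lambda>K. sandwich (kron (1\<^sub>m a) K) \<rho>) (Ks ! m))))"

definition noisy_epr_pairs :: "nat \<Rightarrow> complex mat \<Rightarrow> complex mat" where
  "noisy_epr_pairs n P = sandwich (kron (1\<^sub>m (2 ^ n)) P) (pure_state (epr_pairs n))"

definition corrects :: "nat \<Rightarrow> nat \<Rightarrow> protocol \<Rightarrow> complex mat set \<Rightarrow> bool" where
  "corrects n k \<pi> E \<longleftrightarrow> (\<forall>P\<in>E. \<forall>\<sigma>\<in>final_states \<pi> (2 ^ n) (2 ^ n) (noisy_epr_pairs n P).
     trace_mat \<sigma> \<noteq> 0 \<longrightarrow> (1 / trace_mat \<sigma>) \<cdot>\<^sub>m \<sigma> = pure_state (epr_pairs k))"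

end

theory Submission
  imports Defs
begin

text \<open>
  Errors need only be known up to scalars, and an element \<open>M\<close> of the Pauli group tells apart the errors
  that commute with \<open>M\<close> from those that anticommute. When Alice and Bob both measure the observable \<open>M\<close>
  and compare their outcomes, they learn on which side the error is, and the state becomes a
  maximally entangled state of half the dimension, on which the remaining error acts through a group
  with the same abstract properties (finite, unitary, pairwise commuting or anticommuting,
  irreducible). So the argument is an induction over such error groups, and no Clifford
  operations are needed.

  A second moment estimate over \<open>M\<close> yields an \<open>M\<close> that splits \<open>N\<close> candidate errors into two parts
  differing by at most \<open>sqrt N\<close>. Iterating this alone from \<open>N = 1\<close> is slightly too weak for the claimed
  constant; the loss is made up by the sizes 8 and 26, where the number of anticommuting errors
  has a parity that is itself a character of \<open>M\<close>, so that a weighted estimate gives a more even split.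
  Then \<open>r + 1\<close> measurements suffice for \<open>2 ^ r\<close> candidates.
\<close>

section \<open>Matrices and Kronecker products\<close>

text \<open>The 2 in the bound has two sources. Rounding the logarithm of \<open>card E\<close>
  accounts for one unit, so all uneven splits together may cost only one further measurement. A
  split of \<open>N\<close> candidates deviates by a fraction of about 1 / sqrt N. These fractions
  form a geometric series dominated by the last rounds, where few candidates are left. Hence the
  small sizes are critical, and there integrality and parity can be exploited by hand.

  An eigenspace of \<open>M\<close> has no preferred qubits. Instead of coordinates that turn
  \<open>M\<close> into a Pauli matrix on one qubit, any orthonormal basis of the eigenspace is
  taken: a maximally entangled state keeps its form when Alice uses the complex conjugate of Bob's
  map. The price is that compressed errors are no longer given as tensor products, which is why the
  induction runs over abstract groups. Irreducibility keeps these groups rich enough: errors with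
  equal commutation patterns are proportional, and above dimension 1 there are noncentral elements
  to measure.

  States and errors are tracked only up to a scalar, and the scalar may be 0, which covers
  impossible outcomes.\<close>

lemma mat_adjoint_altdef: "mat_adjoint A = mat (dim_col A) (dim_row A) (\<lambda>(i, j). cnj (A $$ (j, i)))"
  for A :: "complex mat"
  by (rule eq_matI) (auto simp: mat_adjoint_def mat_of_rows_def)

lemma dim_mat_adjoint [simp]:
  "dim_row (mat_adjoint A) = dim_col A" "dim_col (mat_adjoint A) = dim_row A" for A :: "complex mat"
  by (simp_all add: mat_adjoint_altdef)

lemma index_mat_adjoint [simp]:
  "i < dim_col A \<Longrightarrow> j < dim_row A \<Longrightarrow> mat_adjoint A $$ (i, j) = cnj (A $$ (j, i))" for A :: "complex mat"
  by (simp add: mat_adjoint_altdef)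

lemma mat_adjoint_carrier [simp]: "mat_adjoint A \<in> carrier_mat n m \<longleftrightarrow> A \<in> carrier_mat m n"
  for A :: "complex mat"
  unfolding carrier_mat_def mem_Collect_eq dim_mat_adjoint by blast

lemma index_mat_mult:
  "i < dim_row A \<Longrightarrow> j < dim_col B \<Longrightarrow> dim_col A = dim_row B \<Longrightarrow>
     (A * B) $$ (i, j) = (\<Sum>k<dim_row B. A $$ (i, k) * B $$ (k, j))"
  by (simp add: scalar_prod_def atLeast0LessThan)

lemma index_mat_mult_vec:
  "i < dim_row A \<Longrightarrow> dim_col A = dim_vec v \<Longrightarrow> (A *\<^sub>v v) $ i = (\<Sum>k<dim_vec v. A $$ (i, k) * v $ k)"
  by (simp add: scalar_prod_def atLeast0LessThan)

lemma mat_adjoint_mat_adjoint [simp]: "mat_adjoint (mat_adjoint A) = A" for A :: "complex mat"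
  by (rule eq_matI) auto

lemma mat_adjoint_one [simp]: "mat_adjoint (1\<^sub>m n) = (1\<^sub>m n :: complex mat)"
  by (rule eq_matI) auto

lemma mat_adjoint_smult: "mat_adjoint (c \<cdot>\<^sub>m A) = cnj c \<cdot>\<^sub>m mat_adjoint A"
  by (rule eq_matI) auto

lemma mat_adjoint_mult:
  "dim_col A = dim_row B \<Longrightarrow> mat_adjoint (A * B) = mat_adjoint B * mat_adjoint A" for A :: "complex mat"
  by (rule eq_matI) (auto simp: index_mat_mult mult.commute simp del: index_mult_mat(1))

lemma mult_assoc_mat:
  "dim_col A = dim_row B \<Longrightarrow> dim_col B = dim_row C \<Longrightarrow> A * B * C = A * (B * C)"
  for A :: "'a :: semiring_0 mat"
  by (rule assoc_mult_mat[of _ "dim_row A" "dim_row B" _ "dim_row C" _ "dim_col C"]) auto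

lemma smult_mult_left: "dim_col A = dim_row B \<Longrightarrow> (c \<cdot>\<^sub>m A) * B = c \<cdot>\<^sub>m (A * B)"
  for A :: "'a :: comm_semiring_0 mat"
  by (rule mult_smult_assoc_mat[of _ "dim_row A" "dim_row B" _ "dim_col B"]) auto

lemma smult_mult_right: "dim_col A = dim_row B \<Longrightarrow> A * (c \<cdot>\<^sub>m B) = c \<cdot>\<^sub>m (A * B)"
  for A :: "'a :: comm_semiring_0 mat"
  by (rule mult_smult_distrib[of _ "dim_row A" "dim_row B" _ "dim_col B"]) auto

lemma smult_smult_mat: "a \<cdot>\<^sub>m (b \<cdot>\<^sub>m A) = (a * b) \<cdot>\<^sub>m A" for A :: "'a :: semigroup_mult mat"
  by (rule eq_matI) (auto simp: mult.assoc)

lemma one_smult_mat [simp]: "1 \<cdot>\<^sub>m A = A" for A :: "'a :: monoid_mult mat"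
  by (rule eq_matI) auto

lemma zero_smult_mat [simp]: "0 \<cdot>\<^sub>m A = 0\<^sub>m (dim_row A) (dim_col A)" for A :: "'a :: mult_zero mat"
  by (rule eq_matI) auto

lemmas mat_mult_simps = mult_assoc_mat smult_mult_left smult_mult_right smult_smult_mat

lemma trace_mat_comm:
  assumes "dim_col A = dim_row B" "dim_col B = dim_row A"
  shows "trace_mat (A * B) = trace_mat (B * A)"
proof -
  have "trace_mat (A * B) = (\<Sum>i<dim_row A. \<Sum>k<dim_row B. A $$ (i, k) * B $$ (k, i))"
    unfolding trace_mat_def using assms by (intro sum.cong) (auto simp: index_mat_mult simp del: index_mult_mat(1))
  also have "\<dots> = (\<Sum>k<dim_row B. \<Sum>i<dim_row A. B $$ (k, i) * A $$ (i, k))"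
    by (subst sum.swap) (simp add: mult.commute)
  also have "\<dots> = trace_mat (B * A)"
    unfolding trace_mat_def using assms by (intro sum.cong) (auto simp: index_mat_mult simp del: index_mult_mat(1))
  finally show ?thesis .
qed

lemma trace_mat_smult: "dim_row A = dim_col A \<Longrightarrow> trace_mat (c \<cdot>\<^sub>m A) = c * trace_mat A"
  by (auto simp: trace_mat_def sum_distrib_left)

lemma trace_mat_add: "dim_row A = dim_row B \<Longrightarrow> dim_row B = dim_col B \<Longrightarrow> dim_row A = dim_col A \<Longrightarrow>
    trace_mat (A + B) = trace_mat A + trace_mat B"
  by (auto simp: trace_mat_def sum.distrib)

lemma trace_mat_one [simp]: "trace_mat (1\<^sub>m n) = of_nat n"
  by (simp add: trace_mat_def)

lemma sum_div_mod: "(\<Sum>k<a * b. f (k div b) (k mod b)) = (\<Sum>i<a. \<Sum>j<b. f i j)"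
  for f :: "nat \<Rightarrow> nat \<Rightarrow> 'a :: comm_monoid_add"
proof (cases "b = 0")
  case False
  have "(\<Sum>k<a * b. f (k div b) (k mod b)) = (\<Sum>i<a. \<Sum>k = i * b..<i * b + b. f (k div b) (k mod b))"
    by (simp add: sum.nat_group mult.commute)
  also have "\<dots> = (\<Sum>i<a. \<Sum>j<b. f i j)"
  proof (rule sum.cong[OF refl])
    fix i
    have "(\<Sum>k = i * b..<i * b + b. f (k div b) (k mod b)) = (\<Sum>j = 0..<b. f ((j + i * b) div b) ((j + i * b) mod b))"
      using sum.shift_bounds_nat_ivl[of "\<lambda>k. f (k div b) (k mod b)" 0 "i * b" b] by (simp add: add.commute)
    also have "\<dots> = (\<Sum>j<b. f i j)"
      by (rule sum.cong) (auto simp: atLeast0LessThan)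
    finally show "(\<Sum>k = i * b..<i * b + b. f (k div b) (k mod b)) = (\<Sum>j<b. f i j)" .
  qed
  finally show ?thesis .
qed auto

lemma div_mod_less: "k < a * b \<Longrightarrow> k div b < a \<and> k mod b < (b :: nat)"
  by (cases "b = 0") (auto simp: less_mult_imp_div_less)

lemma mult_add_less:
  fixes i a k b :: nat
  assumes "i < a" "k < b"
  shows "i * b + k < a * b"
proof -
  have "i * b + k < Suc i * b" using assms(2) by simp
  also have "\<dots> \<le> a * b" using assms(1) by (intro mult_right_mono) auto
  finally show ?thesis .
qed

lemma dim_kron [simp]:
  "dim_row (kron A B) = dim_row A * dim_row B" "dim_col (kron A B) = dim_col A * dim_col B"
  by (simp_all add: kron_def)

lemma index_kron:
  "i < dim_row A * dim_row B \<Longrightarrow> j < dim_col A * dim_col B \<Longrightarrow>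
   kron A B $$ (i, j) = A $$ (i div dim_row B, j div dim_col B) * B $$ (i mod dim_row B, j mod dim_col B)"
  by (simp add: kron_def)

lemma kron_carrier [simp]:
  "A \<in> carrier_mat a b \<Longrightarrow> B \<in> carrier_mat c d \<Longrightarrow> kron A B \<in> carrier_mat (a * c) (b * d)"
  by (intro carrier_matI) auto

lemma kron_mult:
  assumes "dim_col A = dim_row C" "dim_col B = dim_row D"
  shows "kron A B * kron C D = kron (A * C) (B * D)"
proof (rule eq_matI)
  fix i j assume "i < dim_row (kron (A * C) (B * D))" "j < dim_col (kron (A * C) (B * D))"
  then have i: "i < dim_row A * dim_row B" and j: "j < dim_col C * dim_col D" by auto
  note dm = div_mod_less[OF i] div_mod_less[OF j]
  have "(kron A B * kron C D) $$ (i, j) = (\<Sum>k<dim_row C * dim_row D.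
      A $$ (i div dim_row B, k div dim_row D) * B $$ (i mod dim_row B, k mod dim_row D)
      * (C $$ (k div dim_row D, j div dim_col D) * D $$ (k mod dim_row D, j mod dim_col D)))"
    using i j assms by (subst index_mat_mult) (auto simp: index_kron)
  also have "\<dots> = (\<Sum>k<dim_row C. \<Sum>l<dim_row D.
      A $$ (i div dim_row B, k) * B $$ (i mod dim_row B, l) * (C $$ (k, j div dim_col D) * D $$ (l, j mod dim_col D)))"
    by (rule sum_div_mod)
  also have "\<dots> = (A * C) $$ (i div dim_row B, j div dim_col D) * (B * D) $$ (i mod dim_row B, j mod dim_col D)"
    using dm assms by (simp add: index_mat_mult sum_product mult_ac del: index_mult_mat(1))
  also have "\<dots> = kron (A * C) (B * D) $$ (i, j)"
    using i j by (subst index_kron) auto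
  finally show "(kron A B * kron C D) $$ (i, j) = kron (A * C) (B * D) $$ (i, j)" .
qed auto

lemma kron_adjoint: "mat_adjoint (kron A B) = kron (mat_adjoint A) (mat_adjoint B)"
  by (rule eq_matI) (auto simp: index_kron div_mod_less)

lemma kron_smult_left: "kron (c \<cdot>\<^sub>m A) B = c \<cdot>\<^sub>m kron A B"
  by (rule eq_matI) (auto simp: index_kron div_mod_less)

lemma kron_smult_right: "kron A (c \<cdot>\<^sub>m B) = c \<cdot>\<^sub>m kron A B"
  by (rule eq_matI) (auto simp: index_kron div_mod_less)

lemma kron_one: "kron (1\<^sub>m a) (1\<^sub>m b) = 1\<^sub>m (a * b)"
proof (rule eq_matI)
  fix i j assume "i < dim_row (1\<^sub>m (a * b) :: complex mat)" "j < dim_col (1\<^sub>m (a * b) :: complex mat)"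
  then have ij: "i < a * b" "j < a * b" by auto
  have "i = j \<longleftrightarrow> i div b = j div b \<and> i mod b = j mod b"
    by (metis div_mult_mod_eq)
  then show "kron (1\<^sub>m a) (1\<^sub>m b) $$ (i, j) = 1\<^sub>m (a * b) $$ (i, j)"
    using ij by (auto simp: index_kron div_mod_less)
qed auto

section \<open>Balanced elements and the capacity recursion\<close>

text \<open>Orthogonality of characters in its smallest form: translation by an element of value -1
  reverses the sign of the sum.\<close>

lemma character_sum:
  fixes \<psi> :: "'a \<Rightarrow> int"
  assumes "\<And>B. B \<in> G \<Longrightarrow> bij_betw (m B) G G"
    and pm: "\<And>A. A \<in> G \<Longrightarrow> \<psi> A = 1 \<or> \<psi> A = - 1"
    and mult: "\<And>A B. A \<in> G \<Longrightarrow> B \<in> G \<Longrightarrow> \<psi> (m A B) = \<psi> A * \<psi> B"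
  shows "(\<Sum>A\<in>G. \<psi> A) = (if \<forall>A\<in>G. \<psi> A = 1 then int (card G) else 0)"
proof (cases "\<forall>A\<in>G. \<psi> A = 1")
  case False
  then obtain B where B: "B \<in> G" "\<psi> B = - 1" using pm by blast
  have "(\<Sum>A\<in>G. \<psi> A) = (\<Sum>A\<in>G. \<psi> (m B A))"
    using sum.reindex_bij_betw[OF assms(1)[OF B(1)], of \<psi>] by simp
  also have "\<dots> = - (\<Sum>A\<in>G. \<psi> A)"
    using B mult by (simp add: sum_negf)
  finally have "(\<Sum>A\<in>G. \<psi> A) = 0" by simp
  with False show ?thesis by auto
qed simp

text \<open>If the bound failed everywhere outside \<open>Z\<close>, summing over
  \<open>G - Z\<close> would give a contradiction. Orthogonality makes the sum of the squares over
  \<open>G\<close> equal to \<open>card R * card G\<close>, while each element of \<open>Z\<close>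
  takes the square of \<open>card R\<close>, more than its share. The product over \<open>R\<close>
  is itself a character, so its sum over \<open>G\<close> is never negative, and weighting it by
  \<open>\<beta>\<close> costs at most \<open>\<beta>\<close> for each element of \<open>Z\<close>.
  The assumption on \<open>\<alpha> + \<beta>\<close> pays for this.\<close>

lemma balanced_element_exists:
  fixes \<chi> :: "'b \<Rightarrow> 'a \<Rightarrow> int" and \<alpha> \<beta> :: int
  assumes transl: "\<And>B. B \<in> G \<Longrightarrow> bij_betw (m B) G G"
    and pm: "\<And>P A. P \<in> R \<Longrightarrow> A \<in> G \<Longrightarrow> \<chi> P A = 1 \<or> \<chi> P A = - 1"
    and mult: "\<And>P A B. P \<in> R \<Longrightarrow> A \<in> G \<Longrightarrow> B \<in> G \<Longrightarrow> \<chi> P (m A B) = \<chi> P A * \<chi> P B"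
    and sep: "\<And>P Q. P \<in> R \<Longrightarrow> Q \<in> R \<Longrightarrow> P \<noteq> Q \<Longrightarrow> \<exists>A\<in>G. \<chi> P A \<noteq> \<chi> Q A"
    and fin: "finite G" "finite R"
    and Z: "Z \<subseteq> G" "Z \<noteq> {}" "\<And>P A. P \<in> R \<Longrightarrow> A \<in> Z \<Longrightarrow> \<chi> P A = 1"
    and \<alpha>: "\<alpha> \<ge> int (card R)" and \<beta>: "\<beta> \<ge> 0" and \<alpha>\<beta>: "\<alpha> + \<beta> < (int (card R))\<^sup>2"
  shows "\<exists>A\<in>G - Z. (\<Sum>P\<in>R. \<chi> P A)\<^sup>2 < \<alpha> + \<beta> * (\<Prod>P\<in>R. \<chi> P A)"
proof (rule ccontr)
  define f where "f A = (\<Sum>P\<in>R. \<chi> P A)" for A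
  define \<tau> where "\<tau> A = (\<Prod>P\<in>R. \<chi> P A)" for A
  define N where "N = int (card R)"
  define g where "g = int (card G)"
  define z where "z = int (card Z)"
  assume "\<not> ?thesis"
  then have bad: "\<alpha> + \<beta> * \<tau> A \<le> (f A)\<^sup>2" if "A \<in> G - Z" for A
    using that by (force simp: f_def \<tau>_def not_less)
  have finZ: "finite Z" using Z(1) fin(1) finite_subset by blast
  have z: "z > 0" using Z(2) finZ by (simp add: z_def card_gt_0_iff)
  have gz: "g \<ge> z" using card_mono[OF fin(1) Z(1)] by (simp add: g_def z_def)
  have "(\<Sum>A\<in>G. (f A)\<^sup>2) = (\<Sum>P\<in>R. \<Sum>Q\<in>R. \<Sum>A\<in>G. \<chi> P A * \<chi> Q A)"
    unfolding f_def power2_eq_square sum_product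
    by (subst sum.swap) (intro sum.cong refl, subst sum.swap, rule refl)
  also have "\<dots> = (\<Sum>P\<in>R. \<Sum>Q\<in>R. if P = Q then g else 0)"
  proof (intro sum.cong refl)
    fix P Q assume PQ: "P \<in> R" "Q \<in> R"
    have orth: "(\<Sum>A\<in>G. \<chi> P A * \<chi> Q A) = (if \<forall>A\<in>G. \<chi> P A * \<chi> Q A = 1 then int (card G) else 0)"
    proof (rule character_sum[OF transl])
      fix A assume "A \<in> G"
      then show "\<chi> P A * \<chi> Q A = 1 \<or> \<chi> P A * \<chi> Q A = - 1"
        using pm[OF PQ(1), of A] pm[OF PQ(2), of A] by auto
    qed (auto simp: mult PQ)
    have "\<chi> P A * \<chi> Q A = 1 \<longleftrightarrow> \<chi> P A = \<chi> Q A" if "A \<in> G" for A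
      using pm[OF PQ(1) that] pm[OF PQ(2) that] by auto
    then have eq: "(\<forall>A\<in>G. \<chi> P A * \<chi> Q A = 1) \<longleftrightarrow> P = Q"
      using sep[OF PQ] by auto
    with orth show "(\<Sum>A\<in>G. \<chi> P A * \<chi> Q A) = (if P = Q then g else 0)"
      unfolding eq by (simp add: g_def)
  qed
  also have "\<dots> = N * g"
    using fin by (simp add: N_def)
  finally have total: "(\<Sum>A\<in>G. (f A)\<^sup>2) = N * g" .
  have fZ: "f A = N" "\<tau> A = 1" if "A \<in> Z" for A
    using Z(3) that by (simp_all add: f_def \<tau>_def N_def)
  have "(\<Sum>A\<in>G. (f A)\<^sup>2) = (\<Sum>A\<in>G - Z. (f A)\<^sup>2) + z * N\<^sup>2"
    using sum.subset_diff[OF Z(1) fin(1), of "\<lambda>A. (f A)\<^sup>2"] fZ by (simp add: z_def)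
  with total have upper: "(\<Sum>A\<in>G - Z. (f A)\<^sup>2) = N * g - z * N\<^sup>2" by simp
  have "(\<Sum>A\<in>G. \<tau> A) = (if \<forall>A\<in>G. \<tau> A = 1 then int (card G) else 0)"
  proof (rule character_sum[OF transl])
    fix A assume "A \<in> G"
    then have "\<bar>\<tau> A\<bar> = (\<Prod>P\<in>R. 1)"
      unfolding \<tau>_def abs_prod using pm by (intro prod.cong) fastforce+
    then show "\<tau> A = 1 \<or> \<tau> A = - 1" by (simp add: abs_if split: if_splits)
  qed (auto simp: \<tau>_def mult prod.distrib)
  then have "0 \<le> (\<Sum>A\<in>G. \<tau> A)" by simp
  also have "\<dots> = (\<Sum>A\<in>G - Z. \<tau> A) + z"
    using sum.subset_diff[OF Z(1) fin(1), of \<tau>] fZ by (simp add: z_def)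
  finally have \<tau>: "- z \<le> (\<Sum>A\<in>G - Z. \<tau> A)" by simp
  have "N * g - (\<alpha> + \<beta>) * z \<le> \<alpha> * (g - z) - \<beta> * z"
    using mult_right_mono[OF \<alpha>, of g] by (simp add: N_def g_def algebra_simps)
  also have "\<dots> \<le> \<alpha> * (g - z) + \<beta> * (\<Sum>A\<in>G - Z. \<tau> A)"
    using mult_left_mono[OF \<tau> \<beta>] by simp
  also have "\<dots> = (\<Sum>A\<in>G - Z. \<alpha> + \<beta> * \<tau> A)"
    using Z(1) gz finZ by (simp add: sum.distrib sum_distrib_left card_Diff_subset g_def z_def of_nat_diff algebra_simps)
  also have "\<dots> \<le> (\<Sum>A\<in>G - Z. (f A)\<^sup>2)"
    using bad by (intro sum_mono)
  finally have "N * g - (\<alpha> + \<beta>) * z \<le> N * g - z * N\<^sup>2"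
    unfolding upper .
  then have "z * N\<^sup>2 \<le> z * (\<alpha> + \<beta>)" by (simp add: mult.commute)
  with z \<alpha>\<beta> show False by (simp add: N_def)
qed

text \<open>
  \<open>capacity r\<close> bounds the number of candidate errors that can be resolved by \<open>r\<close> measurements. For
  \<open>r \<ge> 6\<close> the formula is chosen such that \<open>c = capacity (Suc r)\<close> satisfies
  \<open>(c + sqrt c) / 2 \<le> capacity r\<close>; up to \<open>r = 5\<close> the values exploit parity.
\<close>

definition capacity :: "nat \<Rightarrow> real" where
  "capacity r = (if r \<le> 5 then [1, 2, 4, 8, 14, 26] ! r
     else 2 ^ r / 2 + (1 + 1 / sqrt 2) * sqrt (2 ^ r) + (sqrt 2 + 1) / 2)"

lemma capacity_ge: "2 ^ r \<le> capacity (Suc r)"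
proof (cases "r \<le> 4")
  case True
  then have "r \<in> {0, 1, 2, 3, 4}" by auto
  then show ?thesis by (auto simp: capacity_def)
next
  case False
  then have "capacity (Suc r) = 2 ^ r + ((1 + 1 / sqrt 2) * sqrt (2 ^ Suc r) + (sqrt 2 + 1) / 2)"
    by (simp add: capacity_def)
  moreover have "0 \<le> (1 + 1 / sqrt 2) * sqrt (2 ^ Suc r) + (sqrt 2 + 1) / 2"
    by (intro add_nonneg_nonneg mult_nonneg_nonneg divide_nonneg_nonneg) auto
  ultimately show ?thesis by linarith
qed

lemma capacity_ge_one: "1 \<le> capacity r"
proof (cases r)
  case (Suc k)
  then show ?thesis using order_trans[OF one_le_power capacity_ge[of k]] by simp
qed (simp add: capacity_def)

text \<open>With h = sqrt (2 ^ r), take the ansatz h * h / 2 + x * h + y for the capacity and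
  replace the root of \<open>capacity (Suc r)\<close> by its expansion h + x / sqrt 2. Comparing
  coefficients in the recursion then gives x = 1 + 1 / sqrt 2 and y = (sqrt 2 + 1) / 2.\<close>

lemma capacity_step:
  assumes "r \<ge> 6" "N \<le> capacity (Suc r)" "d\<^sup>2 \<le> N"
  shows "(N + d) / 2 \<le> capacity r"
proof -
  define h where "h = sqrt (2 ^ r)"
  define s where "s = sqrt 2"
  have s2: "s * s = 2" by (simp add: s_def)
  have s: "1 < s" "0 < s" by (simp_all add: s_def)
  have h2: "h * h = 2 ^ r" by (simp add: h_def)
  have h0: "h > 0" by (simp add: h_def)
  have inv_s: "1 / s = s / 2" using s2 s by (simp add: field_simps)
  have cap1: "capacity (Suc r) = h * h + (1 + s / 2) * (s * h) + (s + 1) / 2"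
    using assms(1) inv_s by (simp add: capacity_def h2 s_def h_def real_sqrt_mult)
  have cap0: "capacity r = h * h / 2 + (1 + s / 2) * h + (s + 1) / 2"
    using assms(1) inv_s by (simp add: capacity_def h2 s_def h_def)
  \<comment> \<open>A bound for the root of \<open>capacity (Suc r)\<close> that is linear in
    \<open>h\<close>; with it, the recursion becomes an exact equation.\<close>
  define c where "c = h + (s + 1) / 2"
  have c0: "c \<ge> 0" using s h0 by (simp add: c_def)
  have "c\<^sup>2 = h * h + (s + 1) * h + (s * s + 2 * s + 1) / 4"
    by (simp add: c_def power2_eq_square field_simps)
  moreover have "(1 + s / 2) * (s * h) = (s + 1) * h"
    using s2 by (simp add: algebra_simps)
  moreover have "(s * s + 2 * s + 1) / 4 \<ge> (s + 1) / 2" using s2 by simp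
  ultimately have "capacity (Suc r) \<le> c\<^sup>2"
    unfolding cap1 by linarith
  with assms have "d\<^sup>2 \<le> c\<^sup>2" by linarith
  then have "d \<le> c" using c0 by (metis abs_le_square_iff abs_of_nonneg abs_le_D1)
  moreover have "capacity (Suc r) + c = 2 * capacity r"
    using cap1 cap0 s2 by (simp add: c_def algebra_simps)
  ultimately show ?thesis using assms(2) by simp
qed

text \<open>A square below that of the integer \<open>k\<close> leaves a difference of the two part
  sizes \<open>w\<close> and \<open>N - w\<close> below \<open>k\<close>, so twice either part is
  below \<open>N + k\<close>.\<close>

lemma half_le:
  fixes N w k :: nat
  assumes "(int N - 2 * int w)\<^sup>2 < K" "K \<le> (int k)\<^sup>2"
  shows "2 * w < N + k" "N < 2 * w + k"
proof -
  have "\<bar>int N - 2 * int w\<bar> < int k"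
    using assms by (metis abs_of_nat abs_le_square_iff not_less order.strict_trans2)
  then show "2 * w < N + k" "N < 2 * w + k" by auto
qed

text \<open>Here \<open>w\<close> is the number of candidates that anticommute with the measured
  element, and \<open>(- 1) ^ w\<close> is the product of all signs. The choice
  \<open>\<alpha> = N\<close>, \<open>\<beta> = 0\<close> works by integrality except for 8
  candidates with \<open>r = 2\<close> and 26 with \<open>r = 4\<close>, where it would admit parts
  of size 5 and 15.\<close>

lemma capacity_split:
  assumes "2 \<le> N" "real N \<le> capacity (Suc r)"
  shows "\<exists>\<alpha> \<beta>. int N \<le> \<alpha> \<and> 0 \<le> \<beta> \<and> \<alpha> + \<beta> < (int N)\<^sup>2 \<and>
    (\<forall>w\<le>N. (int N - 2 * int w)\<^sup>2 < \<alpha> + \<beta> * (- 1) ^ w \<longrightarrow> real w \<le> capacity r \<and> real (N - w) \<le> capacity r)"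
proof -
  have N2: "int N < (int N)\<^sup>2"
    using assms(1) by (simp add: power2_eq_square)
  consider "r \<ge> 6" | "r = 5" | "r = 2" "N = 8" | "r = 4" "N = 26"
    | "r < 5" "\<not> (r = 2 \<and> N = 8)" "\<not> (r = 4 \<and> N = 26)" by linarith
  then show ?thesis
  proof cases
    case 1
    have "real w \<le> capacity r \<and> real (N - w) \<le> capacity r" if "w \<le> N" "(int N - 2 * int w)\<^sup>2 < int N" for w
    proof -
      define d where "d = real N - 2 * real w"
      have "d\<^sup>2 = real_of_int ((int N - 2 * int w)\<^sup>2)" by (simp add: d_def)
      also have "\<dots> \<le> real_of_int (int N)" using that(2) by (subst of_int_le_iff) simp
      finally have d: "d\<^sup>2 \<le> real N" "(- d)\<^sup>2 \<le> real N" by simp_all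
      show ?thesis
        using capacity_step[OF 1 assms(2) d(1)] capacity_step[OF 1 assms(2) d(2)] that(1)
        by (simp add: d_def of_nat_diff)
    qed
    then show ?thesis using N2 by (intro exI[of _ "int N"] exI[of _ 0]) simp
  next
    case 2
    \<comment> \<open>The formula gives about 46.9 here, so \<open>N\<close> is at most 46 and the
      deviation at most 6. If \<open>capacity 5\<close> were 25 instead of 26, the unweighted
      estimate would stop at 45; this is what the special treatment of 26 gains.\<close>
    have "sqrt 64 = 8" using real_sqrt_pow2[of 8] by (simp add: real_sqrt_eq_iff flip: real_sqrt_abs) 
    then have "capacity (Suc r) = 32 + (1 + 1 / sqrt 2) * 8 + (sqrt 2 + 1) / 2"
      by (simp add: 2 capacity_def)
    moreover have "1 / sqrt 2 = sqrt 2 / 2" by (simp add: field_simps)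
    ultimately have "capacity (Suc r) = 40 + 4 * sqrt 2 + (sqrt 2 + 1) / 2"
      by (simp only:) (simp add: field_simps)
    moreover have "sqrt 2 < 71 / 50" by (rule real_less_lsqrt) (auto simp: power2_eq_square)
    then have "40 + 4 * sqrt 2 + (sqrt 2 + 1) / 2 < 47" by (simp add: field_simps)
    ultimately have "real N < 47" using assms(2) by (metis order.strict_trans1)
    then have "N \<le> 46" by simp
    then have "real w \<le> capacity r \<and> real (N - w) \<le> capacity r" if "w \<le> N" "(int N - 2 * int w)\<^sup>2 < int N" for w
      using half_le[OF that(2), of 7] 2 that(1) by (simp add: capacity_def del: of_nat_diff)
    then show ?thesis using N2 by (intro exI[of _ "int N"] exI[of _ 0]) simp
  next
    case 3
    \<comment> \<open>\<open>8 - 2 * w\<close> is divisible by 4 exactly for even \<open>w\<close>.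
      The bounds 16 for even and 4 for odd \<open>w\<close> therefore leave only the exact split
      \<open>w = 4\<close>; 10 and 6 are half the sum and half the difference of these
      bounds.\<close>
    have "real w \<le> capacity r \<and> real (N - w) \<le> capacity r" if "w \<le> N" "(int N - 2 * int w)\<^sup>2 < 10 + 6 * (- 1) ^ w" for w
    proof (cases "even w")
      case True
      with half_le[of N w 16 4] that(2) 3 show ?thesis by (auto simp: capacity_def simp del: of_nat_diff elim!: evenE)
    next
      case False
      with half_le[of N w 4 2] that(2) 3 show ?thesis by (auto simp: capacity_def simp del: of_nat_diff)
    qed
    then show ?thesis using 3 by (intro exI[of _ 10] exI[of _ 6]) simp
  next
    case 4
    \<comment> \<open>\<open>26 - 2 * w\<close> is divisible by 4 exactly for odd \<open>w\<close>.
      The bounds 36 for even and 16 for odd \<open>w\<close> leave \<open>w\<close> between 12 and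
      14. Again 26 and 10 are half the sum and half the difference, and 26 is the least
      \<open>\<alpha>\<close> allowed.\<close>
    have "real w \<le> capacity r \<and> real (N - w) \<le> capacity r" if "w \<le> N" "(int N - 2 * int w)\<^sup>2 < 26 + 10 * (- 1) ^ w" for w
    proof (cases "even w")
      case True
      with half_le[of N w 36 6] that(2) 4 show ?thesis by (auto simp: capacity_def simp del: of_nat_diff elim!: evenE)
    next
      case False
      with half_le[of N w 16 4] that(2) 4 show ?thesis by (auto simp: capacity_def simp del: of_nat_diff elim!: oddE)
    qed
    then show ?thesis using 4 by (intro exI[of _ 26] exI[of _ 10]) simp
  next
    case 5
    have "real w \<le> capacity r \<and> real (N - w) \<le> capacity r" if "w \<le> N" "(int N - 2 * int w)\<^sup>2 < int N" for w
    proof -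
      consider "r = 0" | "r = 1" | "r = 2" | "r = 3" | "r = 4" using 5(1) by linarith
      then show ?thesis
      proof cases
        case 1
        then show ?thesis using half_le[OF that(2), of 2] assms(2) that(1) by (simp add: capacity_def del: of_nat_diff)
      next
        case 2
        then show ?thesis using half_le[OF that(2), of 2] assms(2) that(1) by (simp add: capacity_def del: of_nat_diff)
      next
        case 3
        then show ?thesis using half_le[OF that(2), of 3] assms(2) that(1) 5 by (simp add: capacity_def del: of_nat_diff)
      next
        case 4
        then show ?thesis using half_le[OF that(2), of 4] assms(2) that(1) by (simp add: capacity_def del: of_nat_diff)
      next
        case 5
        then show ?thesis using half_le[OF that(2), of 5] assms(2) that(1) \<open>\<not> (r = 4 \<and> N = 26)\<close>
          by (simp add: capacity_def del: of_nat_diff)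
      qed
    qed
    then show ?thesis using N2 by (intro exI[of _ "int N"] exI[of _ 0]) simp
  qed
qed

section \<open>Error groups\<close>

text \<open>These are the properties of the Pauli group that survive compression to an eigenspace of
  one of its elements. Irreducibility is stated as the conclusion of Schur's lemma: in terms of
  commutants it can be carried over to Kronecker products and to compressions by direct
  computation.\<close>

locale error_group =
  fixes D :: nat and G :: "complex mat set"
  assumes D_pos: "D > 0"
    and finite_G: "finite G"
    and carrier: "A \<in> G \<Longrightarrow> A \<in> carrier_mat D D"
    and one_closed: "1\<^sub>m D \<in> G"
    and mult_closed: "A \<in> G \<Longrightarrow> B \<in> G \<Longrightarrow> A * B \<in> G"
    and commute_or_anticommute: "A \<in> G \<Longrightarrow> B \<in> G \<Longrightarrow> A * B = B * A \<or> A * B = - 1 \<cdot>\<^sub>m (B * A)"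
    and unitary: "A \<in> G \<Longrightarrow> A * mat_adjoint A = 1\<^sub>m D"
    and adjoint: "A \<in> G \<Longrightarrow> mat_adjoint A = A \<or> mat_adjoint A = - 1 \<cdot>\<^sub>m A"
    and irreducible: "X \<in> carrier_mat D D \<Longrightarrow> (\<And>A. A \<in> G \<Longrightarrow> A * X = X * A) \<Longrightarrow> \<exists>c. X = c \<cdot>\<^sub>m 1\<^sub>m D"
begin

lemma dim [simp]: "A \<in> G \<Longrightarrow> dim_row A = D" "A \<in> G \<Longrightarrow> dim_col A = D"
  using carrier by auto

lemma adjoint_mult: "A \<in> G \<Longrightarrow> mat_adjoint A * A = 1\<^sub>m D"
  using adjoint[of A] unitary[of A] by (auto simp: mat_mult_simps)

lemma neg_neq:
  assumes "A \<in> G" shows "A \<noteq> - 1 \<cdot>\<^sub>m A"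
proof
  assume "A = - 1 \<cdot>\<^sub>m A"
  then have "A * mat_adjoint A = - 1 \<cdot>\<^sub>m (A * mat_adjoint A)"
    using assms by (metis dim(2) dim_mat_adjoint(1) smult_mult_left)
  then have "1\<^sub>m D = - 1 \<cdot>\<^sub>m (1\<^sub>m D :: complex mat)"
    using assms unitary by simp
  then have "1\<^sub>m D $$ (0, 0) = (- 1 \<cdot>\<^sub>m (1\<^sub>m D :: complex mat)) $$ (0, 0)" by simp
  then show False using D_pos by simp
qed

text \<open>The symplectic form on Pauli operators in multiplicative notation. It is integer valued
  so that its sum over a set of errors counts the commuting minus the anticommuting ones.\<close>

definition comm_sgn :: "complex mat \<Rightarrow> complex mat \<Rightarrow> int" where
  "comm_sgn A B = (if A * B = B * A then 1 else - 1)"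

lemma comm_sgn_cases: "comm_sgn A B = 1 \<or> comm_sgn A B = - 1"
  by (simp add: comm_sgn_def)

lemma comm_sgn_sym: "comm_sgn A B = comm_sgn B A"
  by (auto simp: comm_sgn_def)

lemma mult_swap: "A \<in> G \<Longrightarrow> B \<in> G \<Longrightarrow> A * B = of_int (comm_sgn A B) \<cdot>\<^sub>m (B * A)"
  using commute_or_anticommute[of A B] by (auto simp: comm_sgn_def)

lemma comm_sgnI:
  assumes "A \<in> G" "B \<in> G" "A * B = of_int s \<cdot>\<^sub>m (B * A)" "s = 1 \<or> s = - 1"
  shows "comm_sgn A B = s"
  using assms neg_neq[OF mult_closed[OF assms(2,1)]] by (auto simp: comm_sgn_def)

lemma comm_sgn_mult:
  assumes "A \<in> G" "B \<in> G" "C \<in> G"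
  shows "comm_sgn (A * B) C = comm_sgn A C * comm_sgn B C"
proof (rule comm_sgnI)
  have "A * B * C = A * (B * C)" using assms by (simp add: mult_assoc_mat)
  also have "B * C = of_int (comm_sgn B C) \<cdot>\<^sub>m (C * B)" using assms by (intro mult_swap)
  also have "A * \<dots> = of_int (comm_sgn B C) \<cdot>\<^sub>m (A * C * B)"
    using assms by (simp add: mat_mult_simps)
  also have "A * C = of_int (comm_sgn A C) \<cdot>\<^sub>m (C * A)" using assms by (intro mult_swap)
  finally show "A * B * C = of_int (comm_sgn A C * comm_sgn B C) \<cdot>\<^sub>m (C * (A * B))"
    using assms by (simp add: mat_mult_simps mult.commute)
qed (use assms mult_closed comm_sgn_cases[of A C] comm_sgn_cases[of B C] in auto)

lemma bij_mult:
  assumes "B \<in> G" shows "bij_betw ((*) B) G G"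
proof -
  have "inj_on ((*) B) G"
  proof (rule inj_onI)
    fix X Y assume XY: "X \<in> G" "Y \<in> G" "B * X = B * Y"
    have "mat_adjoint B * (B * X) = X" if "X \<in> G" for X
      using assms that adjoint_mult[OF assms] mult_assoc_mat[of "mat_adjoint B" B X] by simp
    then show "X = Y" using XY by metis
  qed
  moreover have "(*) B ` G \<subseteq> G" using assms mult_closed by auto
  ultimately show ?thesis
    using endo_inj_surj[OF finite_G] by (simp add: bij_betw_def)
qed

text \<open>The signs of \<open>P\<close> and \<open>Q\<close> cancel in \<open>P * Q\<close>, which
  therefore commutes with all of \<open>G\<close> and is scalar. Since \<open>Q\<close> is its own
  inverse up to sign, \<open>P\<close> is a multiple of \<open>Q\<close>.\<close>

lemma proportional_of_comm_sgn_eq: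
  assumes "P \<in> G" "Q \<in> G" "\<And>A. A \<in> G \<Longrightarrow> comm_sgn A P = comm_sgn A Q"
  shows "\<exists>u. P = u \<cdot>\<^sub>m Q"
proof -
  have "\<exists>c. P * Q = c \<cdot>\<^sub>m 1\<^sub>m D"
  proof (rule irreducible)
    fix A assume A: "A \<in> G"
    have "comm_sgn (P * Q) A = 1"
      using comm_sgn_mult[OF assms(1,2) A] assms(3)[OF A] comm_sgn_cases[of A Q]
      by (auto simp: comm_sgn_sym)
    then show "A * (P * Q) = P * Q * A"
      by (simp add: comm_sgn_def split: if_splits)
  qed (use assms carrier mult_closed in blast)
  then obtain c where c: "P * Q = c \<cdot>\<^sub>m 1\<^sub>m D" by blast
  obtain e where e: "mat_adjoint Q = e \<cdot>\<^sub>m Q"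
    using adjoint[OF assms(2)] by (metis one_smult_mat)
  have "P = P * (Q * mat_adjoint Q)"
    using assms unitary by (simp add: right_mult_one_mat[OF carrier])
  also have "\<dots> = c \<cdot>\<^sub>m mat_adjoint Q"
    using assms by (simp flip: mult_assoc_mat add: c smult_mult_left)
  also have "\<dots> = (c * e) \<cdot>\<^sub>m Q" by (simp add: e smult_smult_mat)
  finally show ?thesis by blast
qed

text \<open>No measurement separates proportional errors, and none has to. The averaging argument,
  however, requires distinct characters, so one error is kept for each commutation pattern.\<close>

lemma representatives_exist:
  assumes "S \<subseteq> G"
  shows "\<exists>R\<subseteq>S. (\<forall>P\<in>R. \<forall>Q\<in>R. P \<noteq> Q \<longrightarrow> (\<exists>A\<in>G. comm_sgn A P \<noteq> comm_sgn A Q)) \<and>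
    (\<forall>P\<in>S. \<exists>Q\<in>R. \<exists>u. P = u \<cdot>\<^sub>m Q)"
proof -
  define key where "key P = {A \<in> G. comm_sgn A P = 1}" for P
  have key: "key P = key Q \<longleftrightarrow> (\<forall>A\<in>G. comm_sgn A P = comm_sgn A Q)" for P Q
  proof -
    have "comm_sgn A P = comm_sgn A Q \<longleftrightarrow> (comm_sgn A P = 1 \<longleftrightarrow> comm_sgn A Q = 1)" for A
      using comm_sgn_cases[of A P] comm_sgn_cases[of A Q] by auto
    then show ?thesis by (auto simp: key_def)
  qed
  define rep where "rep P = inv_into S key (key P)" for P
  have rep: "rep P \<in> S" "key (rep P) = key P" if "P \<in> S" for P
    using that by (auto simp: rep_def inv_into_into f_inv_into_f)
  have rep_eq: "rep P = rep Q" if "key (rep P) = key (rep Q)" "P \<in> S" "Q \<in> S" for P Q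
    using that rep by (metis rep_def)
  show ?thesis
  proof (intro exI[of _ "rep ` S"] conjI ballI impI)
    fix P Q assume "P \<in> rep ` S" "Q \<in> rep ` S" "P \<noteq> Q"
    then have "key P \<noteq> key Q" using rep_eq by blast
    then show "\<exists>A\<in>G. comm_sgn A P \<noteq> comm_sgn A Q" unfolding key by blast
  next
    fix P assume P: "P \<in> S"
    then have "\<exists>u. P = u \<cdot>\<^sub>m rep P"
      using rep[OF P] assms key by (intro proportional_of_comm_sgn_eq) auto
    with P show "\<exists>Q\<in>rep ` S. \<exists>u. P = u \<cdot>\<^sub>m Q" by blast
  qed (use rep in auto)
qed

text \<open>Otherwise \<open>G\<close> is commutative, hence consists of scalars by irreducibility.
  Then every matrix commutes with \<open>G\<close>, and irreducibility fails for a single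
  off-diagonal matrix unit.\<close>

lemma anticommuting_pair_exists:
  assumes "D > 1"
  shows "\<exists>A\<in>G. \<exists>B\<in>G. comm_sgn A B = - 1"
proof (rule ccontr)
  assume "\<not> ?thesis"
  then have comm: "A * B = B * A" if "A \<in> G" "B \<in> G" for A B
    using that by (auto simp: comm_sgn_def split: if_splits)
  have scalar: "\<exists>c. A = c \<cdot>\<^sub>m 1\<^sub>m D" if "A \<in> G" for A
    using that comm carrier by (intro irreducible) auto
  define X :: "complex mat" where "X = mat D D (\<lambda>(i, j). if i = 0 \<and> j = 1 then 1 else 0)"
  have "\<exists>c. X = c \<cdot>\<^sub>m 1\<^sub>m D"
  proof (rule irreducible)
    fix A assume "A \<in> G"
    then obtain c where A: "A = c \<cdot>\<^sub>m 1\<^sub>m D" using scalar by blast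
    show "A * X = X * A" by (simp add: A mat_mult_simps X_def)
  qed (simp add: X_def)
  then obtain c where "X = c \<cdot>\<^sub>m 1\<^sub>m D" by blast
  moreover have "X $$ (0, 1) = 1" using assms by (simp add: X_def)
  ultimately show False using assms by simp
qed

lemma balanced_measurement_exists:
  assumes R: "R \<subseteq> G" "\<forall>P\<in>R. \<forall>Q\<in>R. P \<noteq> Q \<longrightarrow> (\<exists>A\<in>G. comm_sgn A P \<noteq> comm_sgn A Q)"
    and "D > 1" and card_R: "card R \<le> capacity (Suc r)"
  shows "\<exists>M\<in>G. (\<exists>B\<in>G. comm_sgn M B = - 1) \<and>
    card {P \<in> R. comm_sgn M P = 1} \<le> capacity r \<and> card {P \<in> R. comm_sgn M P = - 1} \<le> capacity r"
proof (cases "card R \<le> 1")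
  case True
  \<comment> \<open>The estimate needs at least two candidates. With at most one, any noncentral
    element will do.\<close>
  have finR: "finite R" using R(1) finite_G finite_subset by blast
  obtain M B where "M \<in> G" "B \<in> G" "comm_sgn M B = - 1"
    using anticommuting_pair_exists[OF assms(3)] by blast
  moreover have "real (card {P \<in> R. Q P}) \<le> capacity r" for Q
  proof -
    have "card {P \<in> R. Q P} \<le> card R" using finR by (intro card_mono) auto
    also have "real (card R) \<le> 1" using True by simp
    also have "1 \<le> capacity r"
      by (rule capacity_ge_one)
    finally show ?thesis by simp
  qed
  ultimately show ?thesis by (intro bexI[of _ M] conjI bexI[of _ B])
next
  case False
  have finR: "finite R" using R(1) finite_G finite_subset by blast
  define N where "N = card R"
  \<comment> \<open>The centre: its elements separate no errors. Outside it there is an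
    anticommuting partner, which will force the two eigenspaces to have equal dimension.\<close>
  define Z where "Z = {A \<in> G. \<forall>B\<in>G. comm_sgn A B = 1}"
  obtain \<alpha> \<beta> where ab: "int N \<le> \<alpha>" "0 \<le> \<beta>" "\<alpha> + \<beta> < (int N)\<^sup>2"
    and split: "\<And>w. w \<le> N \<Longrightarrow> (int N - 2 * int w)\<^sup>2 < \<alpha> + \<beta> * (- 1) ^ w \<Longrightarrow>
        real w \<le> capacity r \<and> real (N - w) \<le> capacity r"
    using capacity_split[of N r] False card_R unfolding N_def by force
  have "\<exists>A\<in>G - Z. (\<Sum>P\<in>R. comm_sgn A P)\<^sup>2 < \<alpha> + \<beta> * (\<Prod>P\<in>R. comm_sgn A P)"
  proof (rule balanced_element_exists[where m = "(*)" and \<chi> = "\<lambda>P A. comm_sgn A P"])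
    show "bij_betw ((*) B) G G" if "B \<in> G" for B using bij_mult that .
    have "comm_sgn (1\<^sub>m D) B = 1" if "B \<in> G" for B
      using that by (simp add: comm_sgn_def)
    then show "Z \<noteq> {}" using one_closed by (auto simp: Z_def)
  qed (use R finR finite_G comm_sgn_cases comm_sgn_mult ab in \<open>auto simp: Z_def N_def\<close>)
  then obtain M where M: "M \<in> G - Z" "(\<Sum>P\<in>R. comm_sgn M P)\<^sup>2 < \<alpha> + \<beta> * (\<Prod>P\<in>R. comm_sgn M P)"
    by blast
  define R0 R1 where "R0 = {P \<in> R. comm_sgn M P = 1}" and "R1 = {P \<in> R. comm_sgn M P = - 1}"
  have R01: "R = R0 \<union> R1" "R0 \<inter> R1 = {}" "finite R0" "finite R1"
    using finR comm_sgn_cases by (auto simp: R0_def R1_def)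
  define w where "w = card R1"
  have N: "N = card R0 + w" unfolding N_def w_def R01(1) by (rule card_Un_disjoint) (use R01 in auto)
  have "(\<Sum>P\<in>R. comm_sgn M P) = (\<Sum>P\<in>R0. 1) + (\<Sum>P\<in>R1. - 1)"
    unfolding R01(1) by (subst sum.union_disjoint) (use R01 in \<open>auto simp: R0_def R1_def\<close>)
  then have sum: "(\<Sum>P\<in>R. comm_sgn M P) = int N - 2 * int w"
    using N by (simp add: w_def)
  have "(\<Prod>P\<in>R. comm_sgn M P) = (\<Prod>P\<in>R0. 1) * (\<Prod>P\<in>R1. - 1)"
    unfolding R01(1) by (subst prod.union_disjoint) (use R01 in \<open>auto simp: R0_def R1_def\<close>)
  then have prod: "(\<Prod>P\<in>R. comm_sgn M P) = (- 1) ^ w"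
    by (simp add: w_def)
  have "real (card R1) \<le> capacity r \<and> real (card R0) \<le> capacity r"
    using split[of w] M(2) N unfolding sum prod by (simp add: w_def)
  moreover have "\<exists>B\<in>G. comm_sgn M B = - 1"
    using M(1) comm_sgn_cases by (auto simp: Z_def)
  ultimately show ?thesis using M(1) by (auto simp: R0_def R1_def)
qed

end

section \<open>Factorization of projections\<close>

text \<open>A Gram-Schmidt step: the new row is the adjoint of a unit vector annihilated by
  \<open>V\<close>.\<close>

lemma isometry_add_row:
  fixes u V :: "complex mat"
  assumes V: "V \<in> carrier_mat d n" "V * mat_adjoint V = 1\<^sub>m d"
    and u: "u \<in> carrier_mat n 1" "mat_adjoint u * u = 1\<^sub>m 1" "V * u = 0\<^sub>m d 1"
  shows "\<exists>W \<in> carrier_mat (Suc d) n. W * mat_adjoint W = 1\<^sub>m (Suc d) \<and>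
    mat_adjoint W * W = mat_adjoint V * V + u * mat_adjoint u"
proof -
  define W where "W = mat (Suc d) n (\<lambda>(i, j). if i < d then V $$ (i, j) else cnj (u $$ (j, 0)))"
  have dims: "dim_row V = d" "dim_col V = n" "dim_row u = n" "dim_col u = 1" "dim_row W = Suc d" "dim_col W = n"
    using V u by (auto simp: W_def)
  have VV: "(\<Sum>k<n. V $$ (i, k) * cnj (V $$ (j, k))) = (if i = j then 1 else 0)" if "i < d" "j < d" for i j
    using arg_cong[OF V(2), of "\<lambda>X. X $$ (i, j)"] that dims by (simp add: index_mat_mult del: index_mult_mat(1))
  have uu: "(\<Sum>k<n. cnj (u $$ (k, 0)) * u $$ (k, 0)) = 1"
    using arg_cong[OF u(2), of "\<lambda>X. X $$ (0, 0)"] dims by (simp add: index_mat_mult del: index_mult_mat(1))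
  have Vu: "(\<Sum>k<n. V $$ (i, k) * u $$ (k, 0)) = 0" if "i < d" for i
    using arg_cong[OF u(3), of "\<lambda>X. X $$ (i, 0)"] that dims by (simp add: index_mat_mult del: index_mult_mat(1))
  have uV: "(\<Sum>k<n. cnj (u $$ (k, 0)) * cnj (V $$ (i, k))) = 0" if "i < d" for i
    using arg_cong[OF Vu[OF that], of cnj] by (simp add: mult.commute)
  have "W * mat_adjoint W = 1\<^sub>m (Suc d)"
  proof (rule eq_matI)
    fix i j assume "i < dim_row (1\<^sub>m (Suc d) :: complex mat)" "j < dim_col (1\<^sub>m (Suc d) :: complex mat)"
    then have ij: "i < Suc d" "j < Suc d" by auto
    then show "(W * mat_adjoint W) $$ (i, j) = 1\<^sub>m (Suc d) $$ (i, j)"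
      using VV Vu uV uu dims
      by (cases "i < d"; cases "j < d") (auto simp: index_mat_mult W_def less_Suc_eq simp del: index_mult_mat(1))
  qed (simp_all add: dims)
  moreover have "mat_adjoint W * W = mat_adjoint V * V + u * mat_adjoint u"
  proof (rule eq_matI)
    fix i j assume "i < dim_row (mat_adjoint V * V + u * mat_adjoint u)" "j < dim_col (mat_adjoint V * V + u * mat_adjoint u)"
    then have ij: "i < n" "j < n" by (auto simp: dims)
    then show "(mat_adjoint W * W) $$ (i, j) = (mat_adjoint V * V + u * mat_adjoint u) $$ (i, j)"
      by (simp add: index_mat_mult dims del: index_mult_mat(1)) (simp add: W_def)
  qed (simp_all add: dims)
  moreover have "W \<in> carrier_mat (Suc d) n" by (simp add: W_def)
  ultimately show ?thesis by blast
qed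

text \<open>The rows of \<open>V\<close> come from an orthonormal basis of the range of
  \<open>E\<close>, which is peeled off one vector at a time, each lowering the trace by 1. Taking
  \<open>t\<close> as a mere bound on the trace keeps its integrality out of the argument: at
  \<open>t = 0\<close> the trace would be negative although it is a sum of squared absolute
  values.\<close>

lemma projection_factorization:
  assumes "E \<in> carrier_mat n n" "E * E = E" "mat_adjoint E = E" "Re (trace_mat E) < real t"
  shows "\<exists>d. \<exists>V \<in> carrier_mat d n. V * mat_adjoint V = 1\<^sub>m d \<and> mat_adjoint V * V = E"
  using assms
proof (induction t arbitrary: E)
  case 0
  have "trace_mat E = (\<Sum>i<n. (E * mat_adjoint E) $$ (i, i))"
    using 0 by (simp add: trace_mat_def)
  also have "\<dots> = (\<Sum>i<n. \<Sum>k<n. complex_of_real ((cmod (E $$ (i, k)))\<^sup>2))"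
    using 0(1) by (intro sum.cong) (auto simp: index_mat_mult complex_norm_square simp del: index_mult_mat(1) of_real_power)
  finally have "Re (trace_mat E) = (\<Sum>i<n. \<Sum>k<n. (cmod (E $$ (i, k)))\<^sup>2)"
    by simp
  then have "Re (trace_mat E) \<ge> 0" by (simp add: sum_nonneg)
  then show ?case using 0 by simp
next
  case (Suc t)
  show ?case
  proof (cases "E = 0\<^sub>m n n")
    case True
    then show ?thesis by (intro exI[of _ 0] bexI[of _ "0\<^sub>m 0 n"]) (auto intro!: eq_matI simp: index_mat_mult simp del: index_mult_mat(1))
  next
    case False
    have dimE: "dim_row E = n" "dim_col E = n" using Suc.prems by auto
    obtain i j where ij: "i < n" "j < n" "E $$ (i, j) \<noteq> 0"
    proof -
      have "\<exists>i<n. \<exists>j<n. E $$ (i, j) \<noteq> 0"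
      proof (rule ccontr)
        assume "\<not> ?thesis"
        then have "E = 0\<^sub>m n n" using dimE by (intro eq_matI) auto
        with False show False by simp
      qed
      with that show ?thesis by blast
    qed
    \<comment> \<open>Every column of \<open>E\<close> is fixed by \<open>E\<close>, so a nonzero
      column divided by the root of \<open>s\<close> is a unit vector in the range.\<close>
    define s where "s = (\<Sum>k<n. (cmod (E $$ (k, j)))\<^sup>2)"
    have "0 < (cmod (E $$ (i, j)))\<^sup>2" using ij by simp
    also have "\<dots> \<le> s" unfolding s_def using ij by (intro member_le_sum) auto
    finally have s: "s > 0" .
    define u where "u = mat n 1 (\<lambda>(k, _). E $$ (k, j) / complex_of_real (sqrt s))"
    have u: "u \<in> carrier_mat n 1" by (simp add: u_def)
    then have dimu: "dim_row u = n" "dim_col u = 1" by auto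
    have ss: "complex_of_real (sqrt s) * complex_of_real (sqrt s) = complex_of_real s"
      using s by (simp flip: of_real_mult)
    have uu: "mat_adjoint u * u = 1\<^sub>m 1"
    proof (rule eq_matI)
      fix a b assume "a < dim_row (1\<^sub>m 1 :: complex mat)" "b < dim_col (1\<^sub>m 1 :: complex mat)"
      then have ab: "a = 0" "b = 0" by auto
      have "(mat_adjoint u * u) $$ (a, b) = (\<Sum>k<n. cnj (E $$ (k, j)) * E $$ (k, j) / complex_of_real s)"
        using ss by (simp add: ab index_mat_mult dimu del: index_mult_mat(1)) (simp add: u_def)
      also have "\<dots> = (\<Sum>k<n. cnj (E $$ (k, j)) * E $$ (k, j)) / complex_of_real s"
        by (simp add: sum_divide_distrib)
      also have "(\<Sum>k<n. cnj (E $$ (k, j)) * E $$ (k, j)) = complex_of_real s"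
        by (simp add: s_def complex_norm_square mult.commute del: of_real_power)
      finally show "(mat_adjoint u * u) $$ (a, b) = 1\<^sub>m 1 $$ (a, b)"
        using s by (simp add: ab)
    qed (simp_all add: dimu)
    have Eu: "E * u = u"
    proof (rule eq_matI)
      fix a b assume "a < dim_row u" "b < dim_col u"
      then have ab: "a < n" "b = 0" by (auto simp: dimu)
      have "(E * u) $$ (a, b) = (\<Sum>k<n. E $$ (a, k) * E $$ (k, j)) / complex_of_real (sqrt s)"
        using ab by (simp add: index_mat_mult dimE dimu sum_divide_distrib del: index_mult_mat(1)) (simp add: u_def)
      also have "(\<Sum>k<n. E $$ (a, k) * E $$ (k, j)) = (E * E) $$ (a, j)"
        using ab ij by (simp add: index_mat_mult dimE del: index_mult_mat(1))
      also have "\<dots> = E $$ (a, j)" using Suc.prems by simp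
      finally show "(E * u) $$ (a, b) = u $$ (a, b)" using ab by (simp add: u_def)
    qed (simp_all add: dimE dimu)
    have uE: "mat_adjoint u * E = mat_adjoint u"
      using arg_cong[OF Eu, of mat_adjoint] Suc.prems(3) by (simp add: mat_adjoint_mult dimE dimu)
    define U where "U = u * mat_adjoint u"
    have U: "U \<in> carrier_mat n n" using u by (simp add: U_def)
    have EU: "E * U = U" "U * E = U" "U * U = U"
    proof -
      show "E * U = U" unfolding U_def using Eu by (simp flip: mult_assoc_mat add: dimE dimu)
      show "U * E = U" unfolding U_def using uE by (simp add: mult_assoc_mat dimE dimu)
      have "U * U = u * (mat_adjoint u * u) * mat_adjoint u"
        unfolding U_def by (simp add: mult_assoc_mat dimu)
      then show "U * U = U" unfolding uu U_def using u by simp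
    qed
    define F where "F = E - U"
    have F: "F \<in> carrier_mat n n" unfolding F_def by (rule minus_carrier_mat[OF U])
    have "F * F = F"
    proof -
      have "F * F = E * E - U * E - (E * U - U * U)"
        unfolding F_def using Suc.prems(1) U
        by (simp add: minus_mult_distrib_mat[of _ n n _ _ n] mult_minus_distrib_mat[of _ n n _ n] minus_carrier_mat)
      also have "\<dots> = F" unfolding EU Suc.prems(2) F_def using Suc.prems(1) U by (intro eq_matI) auto
      finally show ?thesis .
    qed
    moreover have "mat_adjoint F = F"
    proof (rule eq_matI)
      fix a b assume "a < dim_row F" "b < dim_col F"
      then have ab: "a < n" "b < n" using F by auto
      have "cnj (E $$ (b, a)) = E $$ (a, b)"
        using arg_cong[OF Suc.prems(3), of "\<lambda>X. X $$ (a, b)"] ab by (simp add: dimE)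
      then show "mat_adjoint F $$ (a, b) = F $$ (a, b)"
        using ab F U by (simp add: F_def dimE) (simp add: U_def index_mat_mult dimu del: index_mult_mat(1))
    qed (use F in auto)
    moreover have "trace_mat F = trace_mat E - 1"
    proof -
      have "trace_mat U = trace_mat (mat_adjoint u * u)"
        unfolding U_def by (rule trace_mat_comm) (simp_all add: dimu)
      then have "trace_mat U = 1" unfolding uu by simp
      then show ?thesis using U F by (simp add: trace_mat_def F_def dimE sum_subtractf)
    qed
    ultimately obtain d V where V: "V \<in> carrier_mat d n" "V * mat_adjoint V = 1\<^sub>m d" "mat_adjoint V * V = F"
      using Suc.IH[of F] F Suc.prems(4) by auto
    have dimV: "dim_row V = d" "dim_col V = n" using V by auto
    have Fu: "F * u = 0\<^sub>m n 1"
    proof -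
      have "U * u = u * (mat_adjoint u * u)" unfolding U_def by (simp add: mult_assoc_mat dimu)
      then have "U * u = u" unfolding uu using u by simp
      then have "F * u = u - u" unfolding F_def using Eu Suc.prems(1) U u
        by (simp add: minus_mult_distrib_mat[of _ n n _ _ 1])
      then show ?thesis using u by simp
    qed
    \<comment> \<open>Since \<open>V\<close> equals \<open>V * mat_adjoint V * V\<close>, it kills
      whatever \<open>F\<close> kills.\<close>
    have "V * u = V * mat_adjoint V * V * u" using V by simp
    also have "\<dots> = V * (F * u)" by (simp add: V(3)[symmetric] mult_assoc_mat dimV dimu)
    also have "\<dots> = 0\<^sub>m d 1" unfolding Fu using V by simp
    finally have "V * u = 0\<^sub>m d 1" .
    from isometry_add_row[OF V(1,2) u uu this] obtain W where
      W: "W \<in> carrier_mat (Suc d) n" "W * mat_adjoint W = 1\<^sub>m (Suc d)" "mat_adjoint W * W = F + U"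
      unfolding V(3) U_def by blast
    have "F + U = E" unfolding F_def using Suc.prems(1) U by (intro eq_matI) auto
    then show ?thesis using W by blast
  qed
qed

section \<open>Measuring an element of an error group\<close>

context error_group
begin

lemma square:
  assumes "A \<in> G" "mat_adjoint A = e \<cdot>\<^sub>m A" "e = 1 \<or> e = - 1"
  shows "A * A = e \<cdot>\<^sub>m 1\<^sub>m D"
proof -
  have "1\<^sub>m D = e \<cdot>\<^sub>m (A * A)"
    unfolding unitary[OF assms(1), symmetric] assms(2) using assms(1) by (simp add: smult_mult_right)
  then have "e \<cdot>\<^sub>m 1\<^sub>m D = (e * e) \<cdot>\<^sub>m (A * A)"
    by (simp add: smult_smult_mat)
  then show ?thesis using assms(3) by auto
qed

lemma adjoint_sgn:
  assumes "A \<in> G"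
  obtains e where "mat_adjoint A = e \<cdot>\<^sub>m A" "e = 1 \<or> e = - 1" "A * A = e \<cdot>\<^sub>m 1\<^sub>m D"
proof -
  from adjoint[OF assms] have "\<exists>e. mat_adjoint A = e \<cdot>\<^sub>m A \<and> (e = 1 \<or> e = - 1)"
    by (metis one_smult_mat)
  then show ?thesis using square[OF assms] that by blast
qed

text \<open>\<open>N\<close> is \<open>M\<close>, multiplied by the imaginary unit if necessary to
  become Hermitian; its square is then 1, so (1 + N) / 2 projects onto an eigenspace. Conjugation by
  the anticommuting \<open>B\<close> turns \<open>N\<close> into its negative, so the trace of
  \<open>N\<close> vanishes and the eigenspace has half the dimension.\<close>

lemma eigenprojection_factorization:
  assumes M: "M \<in> G" "B \<in> G" "comm_sgn M B = - 1" and D: "D = 2 * d"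
  obtains N V a where "N = a \<cdot>\<^sub>m M" "N * N = 1\<^sub>m D" "V \<in> carrier_mat d D"
    "V * mat_adjoint V = 1\<^sub>m d" "mat_adjoint V * V = (1 / 2) \<cdot>\<^sub>m (1\<^sub>m D + N)"
proof -
  obtain e where e: "mat_adjoint M = e \<cdot>\<^sub>m M" "e = 1 \<or> e = - 1" "M * M = e \<cdot>\<^sub>m 1\<^sub>m D"
    using adjoint_sgn[OF M(1)] .
  define a where "a = (if e = 1 then 1 else \<i>)"
  have a: "a * a * e = 1" "cnj a * e = a"
    using e(2) by (auto simp: a_def)
  define N where "N = a \<cdot>\<^sub>m M"
  have N: "N \<in> carrier_mat D D" using M carrier by (simp add: N_def)
  have dimN: "dim_row N = D" "dim_col N = D" using N by auto
  have NN: "N * N = 1\<^sub>m D"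
    using M a(1) by (simp add: N_def mat_mult_simps e(3) mult.assoc)
  have N_adj: "mat_adjoint N = N"
    using a(2) by (simp add: N_def mat_adjoint_smult e(1) smult_smult_mat)
  have BN: "B * N = - 1 \<cdot>\<^sub>m (N * B)"
    using M mult_swap[of B M] by (simp add: N_def mat_mult_simps comm_sgn_sym[of B] mult.commute)
  have "trace_mat N = trace_mat (N * (B * mat_adjoint B))"
    using M N unitary by simp
  also have "\<dots> = trace_mat (N * B * mat_adjoint B)"
    using M by (simp add: mult_assoc_mat dimN)
  also have "\<dots> = trace_mat (mat_adjoint B * (N * B))"
    using M by (intro trace_mat_comm) (auto simp: dimN)
  also have "N * B = - 1 \<cdot>\<^sub>m (B * N)"
    by (simp add: BN smult_smult_mat)
  also have "mat_adjoint B * \<dots> = - 1 \<cdot>\<^sub>m (mat_adjoint B * B * N)"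
    using M by (simp add: mat_mult_simps dimN)
  also have "\<dots> = - 1 \<cdot>\<^sub>m N"
    using M N adjoint_mult by simp
  also have "trace_mat \<dots> = - trace_mat N"
    by (subst trace_mat_smult) (auto simp: dimN)
  finally have trN: "trace_mat N = 0" by simp
  define E where "E = (1 / 2) \<cdot>\<^sub>m (1\<^sub>m D + N)"
  have E: "E \<in> carrier_mat D D" using N by (simp add: E_def)
  have "(1\<^sub>m D + N) * (1\<^sub>m D + N) = 2 \<cdot>\<^sub>m (1\<^sub>m D + N)"
  proof -
    have "(1\<^sub>m D + N) * (1\<^sub>m D + N) = 1\<^sub>m D * 1\<^sub>m D + 1\<^sub>m D * N + (N * 1\<^sub>m D + N * N)"
      using N by (simp add: add_mult_distrib_mat[of _ D D _ _ D] mult_add_distrib_mat[of _ D D _ D])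
    also have "\<dots> = 2 \<cdot>\<^sub>m (1\<^sub>m D + N)"
      unfolding NN using N by (intro eq_matI) auto
    finally show ?thesis .
  qed
  then have "E * E = E"
    using dimN by (simp add: E_def mat_mult_simps)
  moreover have "mat_adjoint E = E"
  proof (rule eq_matI)
    fix i j assume "i < dim_row E" "j < dim_col E"
    then have ij: "i < D" "j < D" using E by auto
    have "cnj (N $$ (j, i)) = N $$ (i, j)"
      using arg_cong[OF N_adj, of "\<lambda>X. X $$ (i, j)"] ij by (simp add: dimN)
    then show "mat_adjoint E $$ (i, j) = E $$ (i, j)"
      using ij by (simp add: E_def dimN)
  qed (use E in auto)
  moreover have "trace_mat E = of_nat d"
    unfolding E_def by (subst trace_mat_smult, simp_all add: dimN, subst trace_mat_add) (simp_all add: dimN trN D)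
  ultimately obtain d' V where V: "V \<in> carrier_mat d' D" "V * mat_adjoint V = 1\<^sub>m d'" "mat_adjoint V * V = E"
    using projection_factorization[OF E, of "Suc d"] by auto
  \<comment> \<open>The factorization leaves the number of rows open; comparing traces determines
    it.\<close>
  have "of_nat d' = trace_mat (V * mat_adjoint V)" using V by simp
  also have "\<dots> = trace_mat E" unfolding V(3)[symmetric] by (rule trace_mat_comm) auto
  finally have "d' = d" using \<open>trace_mat E = of_nat d\<close> by simp
  then show ?thesis using that[OF N_def NN] V unfolding E_def by blast
qed

end

text \<open>
  \<open>V\<close> restricts to the eigenspace of \<open>M\<close> of one eigenvalue. Since \<open>A\<close> anticommutes with \<open>M\<close>,
  \<open>V * mat_adjoint A\<close> restricts to the other eigenspace.
\<close>

locale measured_error_group = error_group +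
  fixes d :: nat and M N V A :: "complex mat" and a :: complex
  assumes M: "M \<in> G" and A: "A \<in> G" and comm_M_A: "comm_sgn M A = - 1" and D_eq: "D = 2 * d"
    and N: "N = a \<cdot>\<^sub>m M" and N_square: "N * N = 1\<^sub>m D" and V: "V \<in> carrier_mat d D"
    and V_isometry: "V * mat_adjoint V = 1\<^sub>m d"
    and V_projection: "mat_adjoint V * V = (1 / 2) \<cdot>\<^sub>m (1\<^sub>m D + N)"
begin

lemma dims [simp]: "dim_row V = d" "dim_col V = D" "dim_row N = D" "dim_col N = D"
  using V M N by auto

lemma N_carrier: "N \<in> carrier_mat D D"
  by (simp add: carrier_matI)

lemma N_comm: "P \<in> G \<Longrightarrow> P * N = of_int (comm_sgn M P) \<cdot>\<^sub>m (N * P)"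
  using mult_swap[of P M] M by (simp add: N mat_mult_simps comm_sgn_sym[of P] mult.commute)

lemma V_cancel: "dim_row X = d \<Longrightarrow> V * (mat_adjoint V * X) = X"
  using V_isometry by (simp flip: mult_assoc_mat)

lemma N_V_adjoint: "N * mat_adjoint V = mat_adjoint V"
proof -
  have "N * (1\<^sub>m D + N) = N + 1\<^sub>m D"
    using mult_add_distrib_mat[OF N_carrier one_carrier_mat N_carrier] N_square by simp
  then have "N * (1\<^sub>m D + N) = 1\<^sub>m D + N"
    by (simp add: comm_add_mat[OF N_carrier one_carrier_mat])
  then have "N * (mat_adjoint V * V) = mat_adjoint V * V"
    unfolding V_projection by (simp add: mat_mult_simps)
  then have "N * mat_adjoint V * (V * mat_adjoint V) = mat_adjoint V * (V * mat_adjoint V)"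
    by (metis mult_assoc_mat dims dim_mat_adjoint index_mult_mat(2,3))
  then show ?thesis unfolding V_isometry by simp
qed

lemma V_N: "V * N = V"
proof -
  have "(1\<^sub>m D + N) * N = N + 1\<^sub>m D"
    using add_mult_distrib_mat[OF one_carrier_mat N_carrier N_carrier] N_square by simp
  then have "(1\<^sub>m D + N) * N = 1\<^sub>m D + N"
    by (simp add: comm_add_mat[OF N_carrier one_carrier_mat])
  then have "mat_adjoint V * V * N = mat_adjoint V * V"
    unfolding V_projection by (simp add: mat_mult_simps)
  then have "V * mat_adjoint V * (V * N) = V * mat_adjoint V * V"
    by (metis mult_assoc_mat dims dim_mat_adjoint index_mult_mat(2,3))
  then show ?thesis unfolding V_isometry by simp
qed

section \<open>Compression of the group to an eigenspace\<close>

definition compress :: "complex mat \<Rightarrow> complex mat" where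
  "compress Q = V * (Q * mat_adjoint V)"

lemma dim_compress [simp]: "dim_row (compress Q) = d" "dim_col (compress Q) = d"
  by (simp_all add: compress_def)

lemma compress_smult: "dim_row Q = D \<Longrightarrow> dim_col Q = D \<Longrightarrow> compress (c \<cdot>\<^sub>m Q) = c \<cdot>\<^sub>m compress Q"
  by (simp add: compress_def mat_mult_simps)

lemma compress_one: "compress (1\<^sub>m D) = 1\<^sub>m d"
  using V_isometry by (simp add: compress_def)

text \<open>\<open>P\<close> maps the eigenspace into the other one. Algebraically, an
  \<open>N\<close> inserted on the right of \<open>P\<close> and absorbed on the left costs a sign,
  so the block equals its own negative.\<close>

lemma compress_anticommuting:
  assumes "P \<in> G" "comm_sgn M P = - 1"
  shows "compress P = 0\<^sub>m d d"
proof -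
  have "compress P = V * (P * (N * mat_adjoint V))" by (simp add: compress_def N_V_adjoint)
  also have "\<dots> = V * (P * N * mat_adjoint V)" using assms by (simp add: mult_assoc_mat)
  also have "P * N = - 1 \<cdot>\<^sub>m (N * P)" using N_comm[of P] assms by simp
  also have "V * (\<dots> * mat_adjoint V) = - 1 \<cdot>\<^sub>m (V * N * (P * mat_adjoint V))"
    using assms by (simp add: mat_mult_simps)
  also have "\<dots> = - 1 \<cdot>\<^sub>m compress P" by (simp add: V_N compress_def)
  finally have eq: "compress P = - 1 \<cdot>\<^sub>m compress P" .
  show ?thesis
  proof (rule eq_matI)
    fix i j assume "i < dim_row (0\<^sub>m d d :: complex mat)" "j < dim_col (0\<^sub>m d d :: complex mat)"
    then show "compress P $$ (i, j) = 0\<^sub>m d d $$ (i, j)"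
      using arg_cong[OF eq, of "\<lambda>X. X $$ (i, j)"] by simp
  qed simp_all
qed

text \<open>\<open>Q\<close> commutes with \<open>N\<close>, hence with the projection, and leaves
  the eigenspace invariant. This intertwining form makes compression multiplicative and lets
  operators be lifted back to the full space.\<close>

lemma commutes_projection:
  assumes "Q \<in> G" "comm_sgn M Q = 1"
  shows "mat_adjoint V * compress Q = Q * mat_adjoint V" "compress Q * V = V * Q"
proof -
  have QE: "mat_adjoint V * V * Q = Q * (mat_adjoint V * V)"
  proof -
    have QN: "Q * N = N * Q" using N_comm[OF assms(1)] assms(2) by simp
    have "(1\<^sub>m D + N) * Q = Q + N * Q"
      using add_mult_distrib_mat[OF one_carrier_mat N_carrier carrier[OF assms(1)]] assms(1) by simp
    also have "\<dots> = Q * (1\<^sub>m D + N)"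
      using mult_add_distrib_mat[OF carrier[OF assms(1)] one_carrier_mat N_carrier] assms(1) by (simp add: QN)
    finally show ?thesis
      unfolding V_projection using assms(1) by (simp add: smult_mult_left smult_mult_right)
  qed
  have "mat_adjoint V * compress Q = mat_adjoint V * V * Q * mat_adjoint V"
    using assms by (simp add: compress_def mult_assoc_mat)
  also have "\<dots> = Q * (mat_adjoint V * (V * mat_adjoint V))"
    unfolding QE using assms by (simp add: mult_assoc_mat)
  finally show "mat_adjoint V * compress Q = Q * mat_adjoint V"
    using assms V_isometry by simp
  have "compress Q * V = V * (Q * (mat_adjoint V * V))"
    using assms by (simp add: compress_def mult_assoc_mat)
  also have "\<dots> = V * (mat_adjoint V * (V * Q))"
    unfolding QE[symmetric] using assms by (simp add: mult_assoc_mat)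
  finally show "compress Q * V = V * Q"
    using assms by (simp add: V_cancel)
qed

lemma compress_mult:
  assumes "P \<in> G" "Q \<in> G" "comm_sgn M Q = 1"
  shows "compress P * compress Q = compress (P * Q)"
proof -
  have "compress P * compress Q = V * (P * (mat_adjoint V * compress Q))"
    using assms by (simp add: compress_def[of P] mult_assoc_mat)
  then show ?thesis
    unfolding commutes_projection(1)[OF assms(2,3)] using assms by (simp add: compress_def mult_assoc_mat)
qed

lemma compress_adjoint: "Q \<in> G \<Longrightarrow> mat_adjoint (compress Q) = compress (mat_adjoint Q)"
  by (simp add: compress_def mat_adjoint_mult mult_assoc_mat)

definition compressed :: "complex mat set" where
  "compressed = compress ` {Q \<in> G. comm_sgn M Q = 1}"

lemma comm_sgn_mult_right: "B \<in> G \<Longrightarrow> C \<in> G \<Longrightarrow> comm_sgn M (B * C) = comm_sgn M B * comm_sgn M C"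
  using comm_sgn_mult[of B C M] M by (simp add: comm_sgn_sym)

text \<open>
  An operator commuting with the compressed group extends, by copying it to both eigenspaces of
  \<open>M\<close>, to an operator commuting with \<open>G\<close>.
\<close>

lemma compressed_irreducible:
  assumes X: "X \<in> carrier_mat d d" and X_comm: "\<And>B. B \<in> compressed \<Longrightarrow> B * X = X * B"
  shows "\<exists>c. X = c \<cdot>\<^sub>m 1\<^sub>m d"
proof -
  have dimX [simp]: "dim_row X = d" "dim_col X = d" using X by auto
  have dimA [simp]: "dim_row A = D" "dim_col A = D" using A by auto
  obtain e where e: "mat_adjoint A = e \<cdot>\<^sub>m A" "e = 1 \<or> e = - 1" "A * A = e \<cdot>\<^sub>m 1\<^sub>m D"
    using adjoint_sgn[OF A] .
  have ee: "e * e = 1" using e(2) by auto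
  define T where "T = mat_adjoint V * (X * V)"
  have T: "T \<in> carrier_mat D D" unfolding T_def by (intro carrier_matI) auto
  have dimT [simp]: "dim_row T = D" "dim_col T = D" using T by auto
  have T_comm: "Q * T = T * Q" if Q: "Q \<in> G" "comm_sgn M Q = 1" for Q
  proof -
    have X_comm': "compress Q * X = X * compress Q"
      using Q by (intro X_comm) (auto simp: compressed_def)
    have "Q * T = Q * mat_adjoint V * (X * V)" using Q by (simp add: T_def mult_assoc_mat)
    also have "\<dots> = mat_adjoint V * (compress Q * X * V)"
      unfolding commutes_projection(1)[OF Q, symmetric] by (simp add: mult_assoc_mat)
    also have "\<dots> = mat_adjoint V * (X * (compress Q * V))"
      unfolding X_comm' by (simp add: mult_assoc_mat)
    also have "\<dots> = T * Q"
      unfolding commutes_projection(2)[OF Q] using Q by (simp add: T_def mult_assoc_mat)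
    finally show ?thesis .
  qed
  define T' where "T' = A * (T * A)"
  have T': "T' \<in> carrier_mat D D" unfolding T'_def by (intro carrier_matI) auto
  have dimT' [simp]: "dim_row T' = D" "dim_col T' = D" using T' by auto
  have T'_comm: "Q * T' = T' * Q" if Q: "Q \<in> G" "comm_sgn M Q = 1" for Q
  proof -
    define s where "s = (of_int (comm_sgn Q A) :: complex)"
    have QA: "Q * A = s \<cdot>\<^sub>m (A * Q)" using mult_swap[OF Q(1) A] by (simp add: s_def)
    have "Q * T' = Q * A * (T * A)" using Q by (simp add: T'_def mult_assoc_mat)
    also have "\<dots> = s \<cdot>\<^sub>m (A * (Q * T * A))" unfolding QA using Q by (simp add: mat_mult_simps)
    also have "\<dots> = A * (T * (s \<cdot>\<^sub>m (Q * A)))" unfolding T_comm[OF Q] using Q by (simp add: mat_mult_simps)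
    also have "s \<cdot>\<^sub>m (Q * A) = A * Q"
      unfolding QA using comm_sgn_cases[of Q A] by (auto simp: s_def smult_smult_mat)
    also have "A * (T * (A * Q)) = T' * Q" using Q by (simp add: T'_def mult_assoc_mat)
    finally show ?thesis .
  qed
  \<comment> \<open>The inverse of \<open>A\<close> is \<open>e \<cdot>\<^sub>m A\<close>, so the
    second summand is the conjugate of \<open>T\<close> by \<open>A\<close>, that is, the copy of
    \<open>X\<close> on the other eigenspace.\<close>
  define Y where "Y = T + e \<cdot>\<^sub>m T'"
  have Y: "Y \<in> carrier_mat D D" using T T' by (simp add: Y_def)
  have dimY [simp]: "dim_row Y = D" "dim_col Y = D" using Y by auto
  have left_Y: "Q * Y = Q * T + e \<cdot>\<^sub>m (Q * T')" if "Q \<in> G" for Q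
    unfolding Y_def using mult_add_distrib_mat[OF carrier[OF that] T smult_carrier_mat[OF T']] that
    by (simp add: smult_mult_right)
  have right_Y: "Y * Q = T * Q + e \<cdot>\<^sub>m (T' * Q)" if "Q \<in> G" for Q
    unfolding Y_def using add_mult_distrib_mat[OF T smult_carrier_mat[OF T'] carrier[OF that]] that
    by (simp add: smult_mult_left)
  have Y_comm: "Q * Y = Y * Q" if "Q \<in> G" "comm_sgn M Q = 1" for Q
    using that by (simp add: left_Y right_Y T_comm T'_comm)
  have A_comm: "A * Y = Y * A"
  proof -
    have "A * T' = A * A * (T * A)" by (simp add: T'_def mult_assoc_mat)
    then have AT': "A * T' = e \<cdot>\<^sub>m (T * A)"
      unfolding e(3) using T by (simp add: smult_mult_left)
    have "T' * A = A * (T * (A * A))" by (simp add: T'_def mult_assoc_mat)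
    then have T'A: "T' * A = e \<cdot>\<^sub>m (A * T)"
      unfolding e(3) using T by (simp add: smult_mult_right)
    show ?thesis
      unfolding left_Y[OF A] right_Y[OF A] AT' T'A smult_smult_mat ee
      using comm_add_mat[of "A * T" D D "T * A"] carrier[OF A] T by simp
  qed
  have "\<exists>c. Y = c \<cdot>\<^sub>m 1\<^sub>m D"
  proof (rule irreducible[OF Y])
    fix Q assume Q: "Q \<in> G"
    show "Q * Y = Y * Q"
    proof (cases "comm_sgn M Q = 1")
      case False
      then have QA: "comm_sgn M (Q * A) = 1"
        using Q A comm_M_A comm_sgn_cases[of M Q] by (simp add: comm_sgn_mult_right)
      \<comment> \<open>Up to sign, \<open>Q\<close> is the product of \<open>Q * A\<close>, which
        commutes with \<open>M\<close>, and \<open>A\<close>; both factors commute with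
        \<open>Y\<close>.\<close>
      have "e \<cdot>\<^sub>m Q = Q * (A * A)" unfolding e(3) using Q by (simp add: smult_mult_right right_mult_one_mat[OF carrier])
      then have "e \<cdot>\<^sub>m (e \<cdot>\<^sub>m Q) = e \<cdot>\<^sub>m (Q * A * A)" using Q by (simp add: mult_assoc_mat)
      then have Q_eq: "Q = e \<cdot>\<^sub>m (Q * A * A)" by (simp add: smult_smult_mat ee)
      have "Q * A * A * Y = Q * A * (Y * A)" using Q by (simp add: mult_assoc_mat A_comm)
      also have "\<dots> = Q * A * Y * A" using Q by (simp add: mult_assoc_mat)
      also have "\<dots> = Y * (Q * A * A)"
        using Q mult_closed[OF Q A] unfolding Y_comm[OF mult_closed[OF Q A] QA] by (simp add: mult_assoc_mat)
      finally have "Q * A * A * Y = Y * (Q * A * A)" .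
      then show ?thesis
        using Q mult_closed[OF Q A] by (subst (1 2) Q_eq) (simp add: smult_mult_left smult_mult_right)
    qed (use Q Y_comm in blast)
  qed
  then obtain c where c: "Y = c \<cdot>\<^sub>m 1\<^sub>m D" by blast
  \<comment> \<open>Now \<open>Y\<close> is compressed again. The conjugate copy disappears because
    the compression of \<open>A\<close> is 0, and \<open>X\<close> remains.\<close>
  have "V * (T' * mat_adjoint V) = 0\<^sub>m d d"
  proof -
    have "V * (T' * mat_adjoint V) = V * (A * mat_adjoint V) * (X * (V * (A * mat_adjoint V)))"
      by (simp add: T'_def T_def mult_assoc_mat)
    also have "V * (A * mat_adjoint V) = 0\<^sub>m d d"
      using compress_anticommuting[OF A comm_M_A] by (simp add: compress_def)
    finally show ?thesis using X by simp
  qed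
  moreover have "V * (T * mat_adjoint V) = X"
    using V_isometry X by (simp add: T_def mult_assoc_mat V_cancel)
  moreover have "V * (Y * mat_adjoint V) = V * (T * mat_adjoint V) + e \<cdot>\<^sub>m (V * (T' * mat_adjoint V))"
  proof -
    have V': "mat_adjoint V \<in> carrier_mat D d" using V by simp
    have "Y * mat_adjoint V = T * mat_adjoint V + e \<cdot>\<^sub>m (T' * mat_adjoint V)"
      unfolding Y_def using add_mult_distrib_mat[OF T smult_carrier_mat[OF T'] V'] by (simp add: smult_mult_left)
    then show ?thesis
      using mult_add_distrib_mat[OF V mult_carrier_mat[OF T V'] smult_carrier_mat[OF mult_carrier_mat[OF T' V']]]
      by (simp add: smult_mult_right)
  qed
  ultimately have "V * (Y * mat_adjoint V) = X" using X by simp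
  moreover have "V * (Y * mat_adjoint V) = c \<cdot>\<^sub>m 1\<^sub>m d"
    unfolding c using V_isometry by (simp add: smult_mult_left smult_mult_right)
  ultimately show ?thesis by metis
qed

lemma error_group_compressed: "error_group d compressed"
proof
  show "d > 0" using D_pos D_eq by simp
  show "finite compressed" using finite_G by (simp add: compressed_def)
  have "comm_sgn M (1\<^sub>m D) = 1" using M by (simp add: comm_sgn_def)
  then show "1\<^sub>m d \<in> compressed"
    using one_closed compress_one unfolding compressed_def by (metis (mono_tags, lifting) image_eqI mem_Collect_eq)
next
  fix B assume "B \<in> compressed"
  then obtain Q where Q: "B = compress Q" "Q \<in> G" "comm_sgn M Q = 1" by (auto simp: compressed_def)
  obtain e where e: "mat_adjoint Q = e \<cdot>\<^sub>m Q" "e = 1 \<or> e = - 1" "Q * Q = e \<cdot>\<^sub>m 1\<^sub>m D"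
    using adjoint_sgn[OF Q(2)] .
  show "B \<in> carrier_mat d d" by (simp add: Q carrier_matI)
  have adj: "mat_adjoint B = e \<cdot>\<^sub>m B"
    unfolding Q(1) compress_adjoint[OF Q(2)] e(1) using Q(2) by (simp add: compress_smult)
  show "mat_adjoint B = B \<or> mat_adjoint B = - 1 \<cdot>\<^sub>m B"
    unfolding adj using e(2) by auto
  have "B * mat_adjoint B = e \<cdot>\<^sub>m compress (Q * Q)"
    unfolding adj unfolding Q(1) by (simp add: smult_mult_right compress_mult Q)
  also have "\<dots> = 1\<^sub>m d"
    unfolding e(3) using e(2) by (auto simp: compress_smult compress_one smult_smult_mat)
  finally show "B * mat_adjoint B = 1\<^sub>m d" .
next
  fix B C assume "B \<in> compressed" "C \<in> compressed"
  then obtain P Q where P: "B = compress P" "P \<in> G" "comm_sgn M P = 1"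
    and Q: "C = compress Q" "Q \<in> G" "comm_sgn M Q = 1" by (auto simp: compressed_def)
  show "B * C \<in> compressed"
    unfolding P(1) Q(1) compress_mult[OF P(2) Q(2,3)] compressed_def
    using P Q by (intro imageI) (simp add: mult_closed comm_sgn_mult_right)
  show "B * C = C * B \<or> B * C = - 1 \<cdot>\<^sub>m (C * B)"
    unfolding P(1) Q(1) compress_mult[OF P(2) Q(2,3)] compress_mult[OF Q(2) P(2,3)]
    using commute_or_anticommute[OF P(2) Q(2)] P(2) Q(2) by (auto simp: compress_smult)
next
  fix X assume "X \<in> carrier_mat d d" "\<And>B. B \<in> compressed \<Longrightarrow> B * X = X * B"
  then show "\<exists>c. X = c \<cdot>\<^sub>m 1\<^sub>m d" by (rule compressed_irreducible)
qed

section \<open>Pairs of outcomes and the remaining error\<close>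

definition eigenspace_map :: "bool \<Rightarrow> complex mat" where
  "eigenspace_map b = (if b then V * mat_adjoint A else V)"

text \<open>An error that anticommutes with \<open>M\<close> moves the state to the other
  eigenspace; multiplication by \<open>A\<close> brings it back. Since the two eigenspaces are
  identified through \<open>A\<close>, the remaining error is, up to a scalar, the same for all
  pairs of outcomes.\<close>

definition residual :: "complex mat \<Rightarrow> complex mat" where
  "residual P = compress (if comm_sgn M P = 1 then P else A * P)"

lemma eigenspace_map_carrier: "eigenspace_map b \<in> carrier_mat d D"
  using V carrier[OF A] by (auto simp: eigenspace_map_def intro!: mult_carrier_mat)

text \<open>Conjugation by \<open>A\<close> turns \<open>N\<close> into its negative, so the two
  summands are the complementary projections (1 + N) / 2 and (1 - N) / 2.\<close>

lemma eigenspace_map_complete: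
  "mat_adjoint (eigenspace_map False) * eigenspace_map False
    + mat_adjoint (eigenspace_map True) * eigenspace_map True = 1\<^sub>m D"
proof -
  have dimA [simp]: "dim_row A = D" "dim_col A = D" using A by auto
  have A': "mat_adjoint A \<in> carrier_mat D D" using carrier[OF A] by simp
  have "mat_adjoint (V * mat_adjoint A) * (V * mat_adjoint A) = A * ((mat_adjoint V * V) * mat_adjoint A)"
    by (simp add: mat_adjoint_mult mult_assoc_mat)
  also have "\<dots> = (1 / 2) \<cdot>\<^sub>m (A * ((1\<^sub>m D + N) * mat_adjoint A))"
    unfolding V_projection by (simp add: mat_mult_simps)
  also have "(1\<^sub>m D + N) * mat_adjoint A = mat_adjoint A + N * mat_adjoint A"
    using add_mult_distrib_mat[OF one_carrier_mat N_carrier A'] by simp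
  also have "A * (mat_adjoint A + N * mat_adjoint A) = 1\<^sub>m D + A * N * mat_adjoint A"
    using mult_add_distrib_mat[OF carrier[OF A] A' mult_carrier_mat[OF N_carrier A']]
    by (simp add: unitary[OF A] mult_assoc_mat)
  also have "A * N = - 1 \<cdot>\<^sub>m (N * A)" using N_comm[OF A] comm_M_A by simp
  also have "(- 1 \<cdot>\<^sub>m (N * A)) * mat_adjoint A = - 1 \<cdot>\<^sub>m N"
    using unitary[OF A] N_carrier by (simp add: mat_mult_simps)
  finally have 1: "mat_adjoint (V * mat_adjoint A) * (V * mat_adjoint A) = (1 / 2) \<cdot>\<^sub>m (1\<^sub>m D + - 1 \<cdot>\<^sub>m N)" .
  show ?thesis
    unfolding eigenspace_map_def if_True if_False 1 V_projection
    by (rule eq_matI) (auto simp: field_simps)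
qed

lemma residual_in_compressed: "P \<in> G \<Longrightarrow> residual P \<in> compressed"
  unfolding residual_def compressed_def using A comm_M_A comm_sgn_cases[of M P]
  by (intro imageI) (auto simp: mult_closed comm_sgn_mult_right)

text \<open>Moving \<open>A\<close> through \<open>P\<close> reduces all four blocks to
  \<open>compress P\<close> and \<open>compress (A * P)\<close>, one of which vanishes because
  \<open>P\<close> or \<open>A * P\<close> anticommutes with \<open>M\<close>. The clause on
  \<open>u\<close> says that a comparison result contradicting the sign of the error has probability
  0; \<open>b\<close> is Alice's outcome and \<open>b'\<close> is Bob's.\<close>

lemma branch_error:
  assumes P: "P \<in> G"
  shows "\<exists>u. eigenspace_map b' * (P * mat_adjoint (eigenspace_map b)) = u \<cdot>\<^sub>m residual P \<and>
    ((b = b') \<noteq> (comm_sgn M P = 1) \<longrightarrow> u = 0)"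
proof -
  have dimA [simp]: "dim_row A = D" "dim_col A = D" using A by auto
  obtain e where e: "mat_adjoint A = e \<cdot>\<^sub>m A" "e = 1 \<or> e = - 1" "A * A = e \<cdot>\<^sub>m 1\<^sub>m D"
    using adjoint_sgn[OF A] .
  define s where "s = (of_int (comm_sgn P A) :: complex)"
  have PA: "P * A = s \<cdot>\<^sub>m (A * P)" using mult_swap[OF P A] by (simp add: s_def)
  have dimP [simp]: "dim_row P = D" "dim_col P = D" using P by auto
  have cFF: "eigenspace_map False * (P * mat_adjoint (eigenspace_map False)) = compress P"
    by (simp add: eigenspace_map_def compress_def)
  have cFT: "eigenspace_map False * (P * mat_adjoint (eigenspace_map True)) = s \<cdot>\<^sub>m compress (A * P)"
  proof -
    have "eigenspace_map False * (P * mat_adjoint (eigenspace_map True)) = compress (P * A)"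
      by (simp add: eigenspace_map_def compress_def mat_adjoint_mult mult_assoc_mat)
    then show ?thesis by (simp add: PA compress_smult)
  qed
  have cTF: "eigenspace_map True * (P * mat_adjoint (eigenspace_map False)) = e \<cdot>\<^sub>m compress (A * P)"
    by (simp add: eigenspace_map_def compress_def mat_mult_simps e(1))
  have cTT: "eigenspace_map True * (P * mat_adjoint (eigenspace_map True)) = s \<cdot>\<^sub>m compress P"
  proof -
    have "eigenspace_map True * (P * mat_adjoint (eigenspace_map True)) = compress (mat_adjoint A * (P * A))"
      by (simp add: eigenspace_map_def compress_def mat_adjoint_mult mult_assoc_mat)
    also have "mat_adjoint A * (P * A) = s \<cdot>\<^sub>m (mat_adjoint A * A * P)"
      unfolding PA by (simp add: mat_mult_simps)
    also have "\<dots> = s \<cdot>\<^sub>m P" using adjoint_mult[OF A] carrier[OF P] by simp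
    finally show ?thesis by (simp add: compress_smult)
  qed
  show ?thesis
  proof (cases "comm_sgn M P = 1")
    case True
    then have "comm_sgn M (A * P) = - 1"
      using A P comm_M_A by (simp add: comm_sgn_mult_right)
    then have "compress (A * P) = 0\<^sub>m d d" by (intro compress_anticommuting mult_closed A P)
    moreover have "residual P = compress P" using True by (simp add: residual_def)
    moreover have "compress P = 1 \<cdot>\<^sub>m compress P" "s \<cdot>\<^sub>m (0\<^sub>m d d) = 0 \<cdot>\<^sub>m compress P" "e \<cdot>\<^sub>m (0\<^sub>m d d) = 0 \<cdot>\<^sub>m compress P"
      by auto
    ultimately show ?thesis
      using True cFF cFT cTF cTT by (cases b; cases b') metis+
  next
    case False
    then have "comm_sgn M P = - 1" using comm_sgn_cases[of M P] by blast
    then have "compress P = 0\<^sub>m d d" by (intro compress_anticommuting P)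
    moreover have "residual P = compress (A * P)" using False by (simp add: residual_def)
    moreover have "0\<^sub>m d d = 0 \<cdot>\<^sub>m compress (A * P)" "s \<cdot>\<^sub>m (0\<^sub>m d d) = 0 \<cdot>\<^sub>m compress (A * P)"
      by auto
    ultimately show ?thesis
      using False cFF cFT cTF cTT by (cases b; cases b') metis+
  qed
qed

end

section \<open>The Pauli group is contained in an error group\<close>

lemma kron_id_mult_index:
  assumes X: "X \<in> carrier_mat (a * b) (a * b)" and B: "B \<in> carrier_mat b b"
    and ij: "i < a" "k < b" "q < a * b"
  shows "(kron (1\<^sub>m a) B * X) $$ (i * b + k, q) = (\<Sum>m<b. B $$ (k, m) * X $$ (i * b + m, q))"
    "(X * kron (1\<^sub>m a) B) $$ (q, i * b + k) = (\<Sum>m<b. X $$ (q, i * b + m) * B $$ (m, k))"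
proof -
  have dims: "dim_row X = a * b" "dim_col X = a * b" "dim_row B = b" "dim_col B = b" using X B by auto
  have lt: "i * b + k < a * b" using ij by (simp add: mult_add_less)
  have dm: "(i * b + k) div b = i" "(i * b + k) mod b = k" using ij by simp_all
  have "(kron (1\<^sub>m a) B * X) $$ (i * b + k, q)
      = (\<Sum>p<a * b. (if i = p div b then 1 else 0) * B $$ (k, p mod b) * X $$ (p div b * b + p mod b, q))"
    using lt ij dims by (subst index_mat_mult) (auto simp: index_kron dm div_mod_less intro!: sum.cong)
  also have "\<dots> = (\<Sum>p<a. \<Sum>m<b. (if i = p then 1 else 0) * B $$ (k, m) * X $$ (p * b + m, q))"
    by (rule sum_div_mod)
  also have "\<dots> = (\<Sum>p<a. if i = p then \<Sum>m<b. B $$ (k, m) * X $$ (p * b + m, q) else 0)"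
    by (intro sum.cong) auto
  finally show "(kron (1\<^sub>m a) B * X) $$ (i * b + k, q) = (\<Sum>m<b. B $$ (k, m) * X $$ (i * b + m, q))"
    using ij by simp
  have "(X * kron (1\<^sub>m a) B) $$ (q, i * b + k)
      = (\<Sum>p<a * b. X $$ (q, p div b * b + p mod b) * ((if p div b = i then 1 else 0) * B $$ (p mod b, k)))"
    using lt ij dims by (subst index_mat_mult) (auto simp: index_kron dm div_mod_less intro!: sum.cong)
  also have "\<dots> = (\<Sum>p<a. \<Sum>m<b. X $$ (q, p * b + m) * ((if p = i then 1 else 0) * B $$ (m, k)))"
    by (rule sum_div_mod)
  also have "\<dots> = (\<Sum>p<a. if p = i then \<Sum>m<b. X $$ (q, p * b + m) * B $$ (m, k) else 0)"
    by (intro sum.cong) auto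
  finally show "(X * kron (1\<^sub>m a) B) $$ (q, i * b + k) = (\<Sum>m<b. X $$ (q, i * b + m) * B $$ (m, k))"
    using ij by simp
qed

lemma kron_mult_id_index:
  assumes X: "X \<in> carrier_mat (a * b) (a * b)" and A: "A \<in> carrier_mat a a"
    and ij: "i < a" "k < b" "q < a * b"
  shows "(kron A (1\<^sub>m b) * X) $$ (i * b + k, q) = (\<Sum>m<a. A $$ (i, m) * X $$ (m * b + k, q))"
    "(X * kron A (1\<^sub>m b)) $$ (q, i * b + k) = (\<Sum>m<a. X $$ (q, m * b + k) * A $$ (m, i))"
proof -
  have dims: "dim_row X = a * b" "dim_col X = a * b" "dim_row A = a" "dim_col A = a" using X A by auto
  have lt: "i * b + k < a * b" using ij by (simp add: mult_add_less)
  have dm: "(i * b + k) div b = i" "(i * b + k) mod b = k" using ij by simp_all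
  have "(kron A (1\<^sub>m b) * X) $$ (i * b + k, q)
      = (\<Sum>p<a * b. A $$ (i, p div b) * (if k = p mod b then 1 else 0) * X $$ (p div b * b + p mod b, q))"
    using lt ij dims by (subst index_mat_mult) (auto simp: index_kron dm div_mod_less intro!: sum.cong)
  also have "\<dots> = (\<Sum>p<a. \<Sum>m<b. A $$ (i, p) * (if k = m then 1 else 0) * X $$ (p * b + m, q))"
    by (rule sum_div_mod)
  also have "\<dots> = (\<Sum>p<a. \<Sum>m<b. if k = m then A $$ (i, p) * X $$ (p * b + m, q) else 0)"
    by (intro sum.cong) auto
  finally show "(kron A (1\<^sub>m b) * X) $$ (i * b + k, q) = (\<Sum>m<a. A $$ (i, m) * X $$ (m * b + k, q))"
    using ij by simp
  have "(X * kron A (1\<^sub>m b)) $$ (q, i * b + k)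
      = (\<Sum>p<a * b. X $$ (q, p div b * b + p mod b) * (A $$ (p div b, i) * (if p mod b = k then 1 else 0)))"
    using lt ij dims by (subst index_mat_mult) (auto simp: index_kron dm div_mod_less intro!: sum.cong)
  also have "\<dots> = (\<Sum>p<a. \<Sum>m<b. X $$ (q, p * b + m) * (A $$ (p, i) * (if m = k then 1 else 0)))"
    by (rule sum_div_mod)
  also have "\<dots> = (\<Sum>p<a. \<Sum>m<b. if m = k then X $$ (q, p * b + m) * A $$ (p, i) else 0)"
    by (intro sum.cong) auto
  finally show "(X * kron A (1\<^sub>m b)) $$ (q, i * b + k) = (\<Sum>m<a. X $$ (q, m * b + k) * A $$ (m, i))"
    using ij by simp
qed

text \<open>For irreducibility, commuting with all \<open>kron (1\<^sub>m a) B\<close> makes every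
  block of \<open>X\<close> scalar. The matrix of these scalars commutes with \<open>G\<close>, so
  it is scalar too.\<close>

lemma error_group_kron:
  assumes "error_group a G" "error_group b H"
  shows "error_group (a * b) {kron A B | A B. A \<in> G \<and> B \<in> H}"
proof -
  interpret G: error_group a G by fact
  interpret H: error_group b H by fact
  show ?thesis
  proof
    show "a * b > 0" using G.D_pos H.D_pos by simp
    have "{kron A B | A B. A \<in> G \<and> B \<in> H} = (\<lambda>(A, B). kron A B) ` (G \<times> H)" by auto
    then show "finite {kron A B | A B. A \<in> G \<and> B \<in> H}" using G.finite_G H.finite_G by simp
    show "1\<^sub>m (a * b) \<in> {kron A B | A B. A \<in> G \<and> B \<in> H}"
      using kron_one[of a b] G.one_closed H.one_closed by (auto intro!: exI)
  next
    fix K assume "K \<in> {kron A B | A B. A \<in> G \<and> B \<in> H}"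
    then obtain A B where K: "K = kron A B" "A \<in> G" "B \<in> H" by blast
    show "K \<in> carrier_mat (a * b) (a * b)"
      unfolding K(1) using K G.carrier H.carrier by (intro kron_carrier) auto
    show "K * mat_adjoint K = 1\<^sub>m (a * b)"
      unfolding K(1) kron_adjoint using K by (simp add: kron_mult G.unitary H.unitary kron_one)
    show "mat_adjoint K = K \<or> mat_adjoint K = - 1 \<cdot>\<^sub>m K"
      unfolding K(1) kron_adjoint using G.adjoint[OF K(2)] H.adjoint[OF K(3)]
      by (elim disjE) (simp_all add: kron_smult_left kron_smult_right smult_smult_mat)
  next
    fix K L assume "K \<in> {kron A B | A B. A \<in> G \<and> B \<in> H}" "L \<in> {kron A B | A B. A \<in> G \<and> B \<in> H}"
    then obtain A B C E where K: "K = kron A B" "A \<in> G" "B \<in> H" and L: "L = kron C E" "C \<in> G" "E \<in> H"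
      by blast
    have KL: "K * L = kron (A * C) (B * E)" "L * K = kron (C * A) (E * B)"
      using K L by (simp_all add: kron_mult)
    show "K * L \<in> {kron A B | A B. A \<in> G \<and> B \<in> H}"
      unfolding KL using G.mult_closed[OF K(2) L(2)] H.mult_closed[OF K(3) L(3)] by blast
    show "K * L = L * K \<or> K * L = - 1 \<cdot>\<^sub>m (L * K)"
      unfolding KL using G.commute_or_anticommute[OF K(2) L(2)] H.commute_or_anticommute[OF K(3) L(3)]
      by (elim disjE) (simp_all add: kron_smult_left kron_smult_right smult_smult_mat)
  next
    fix X assume X: "X \<in> carrier_mat (a * b) (a * b)"
      and X_comm: "\<And>K. K \<in> {kron A B | A B. A \<in> G \<and> B \<in> H} \<Longrightarrow> K * X = X * K"
    note lt = mult_add_less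
    have block: "\<exists>c. mat b b (\<lambda>(k, l). X $$ (i * b + k, j * b + l)) = c \<cdot>\<^sub>m 1\<^sub>m b" if ij: "i < a" "j < a" for i j
    proof (rule H.irreducible)
      fix B assume B: "B \<in> H"
      have eq: "kron (1\<^sub>m a) B * X = X * kron (1\<^sub>m a) B" using X_comm G.one_closed B by blast
      show "B * mat b b (\<lambda>(k, l). X $$ (i * b + k, j * b + l)) = mat b b (\<lambda>(k, l). X $$ (i * b + k, j * b + l)) * B"
      proof (rule eq_matI)
        fix k l assume "k < dim_row (mat b b (\<lambda>(k, l). X $$ (i * b + k, j * b + l)) * B)"
          "l < dim_col (mat b b (\<lambda>(k, l). X $$ (i * b + k, j * b + l)) * B)"
        then have kl: "k < b" "l < b" using B by auto
        show "(B * mat b b (\<lambda>(k, l). X $$ (i * b + k, j * b + l))) $$ (k, l) =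
            (mat b b (\<lambda>(k, l). X $$ (i * b + k, j * b + l)) * B) $$ (k, l)"
          using arg_cong[OF eq, of "\<lambda>Y. Y $$ (i * b + k, j * b + l)"]
            kron_id_mult_index(1)[OF X H.carrier[OF B] ij(1) kl(1) lt[OF ij(2) kl(2)]]
            kron_id_mult_index(2)[OF X H.carrier[OF B] ij(2) kl(2) lt[OF ij(1) kl(1)]] kl B
          by (simp add: index_mat_mult del: index_mult_mat(1))
      qed (use B in auto)
    qed simp
    \<comment> \<open>As the blocks are scalar, their upper left entries carry all the
      information.\<close>
    define x where "x = mat a a (\<lambda>(i, j). X $$ (i * b, j * b))"
    have X_index: "X $$ (i * b + k, j * b + l) = (if k = l then x $$ (i, j) else 0)"
      if ij: "i < a" "j < a" and kl: "k < b" "l < b" for i j k l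
    proof -
      obtain c where c: "mat b b (\<lambda>(k, l). X $$ (i * b + k, j * b + l)) = c \<cdot>\<^sub>m 1\<^sub>m b"
        using block[OF ij] by blast
      have "X $$ (i * b + 0, j * b + 0) = c"
        using arg_cong[OF c, of "\<lambda>Y. Y $$ (0, 0)"] H.D_pos by simp
      moreover have "X $$ (i * b + k, j * b + l) = (if k = l then c else 0)"
        using arg_cong[OF c, of "\<lambda>Y. Y $$ (k, l)"] kl by simp
      ultimately show ?thesis using ij by (simp add: x_def)
    qed
    have "\<exists>c. x = c \<cdot>\<^sub>m 1\<^sub>m a"
    proof (rule G.irreducible)
      fix A assume A: "A \<in> G"
      have eq: "kron A (1\<^sub>m b) * X = X * kron A (1\<^sub>m b)" using X_comm H.one_closed A by blast
      show "A * x = x * A"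
      proof (rule eq_matI)
        fix i j assume "i < dim_row (x * A)" "j < dim_col (x * A)"
        then have ij: "i < a" "j < a" using A by (auto simp: x_def)
        show "(A * x) $$ (i, j) = (x * A) $$ (i, j)"
          using arg_cong[OF eq, of "\<lambda>Y. Y $$ (i * b + 0, j * b + 0)"]
            kron_mult_id_index(1)[OF X G.carrier[OF A] ij(1) H.D_pos lt[OF ij(2) H.D_pos]]
            kron_mult_id_index(2)[OF X G.carrier[OF A] ij(2) H.D_pos lt[OF ij(1) H.D_pos]] ij A
          by (simp add: index_mat_mult x_def del: index_mult_mat(1))
      qed (use A in \<open>auto simp: x_def\<close>)
    qed (simp add: x_def)
    then obtain c where c: "x = c \<cdot>\<^sub>m 1\<^sub>m a" by blast
    have "X = c \<cdot>\<^sub>m 1\<^sub>m (a * b)"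
    proof (rule eq_matI)
      fix p q assume "p < dim_row (c \<cdot>\<^sub>m 1\<^sub>m (a * b))" "q < dim_col (c \<cdot>\<^sub>m 1\<^sub>m (a * b))"
      then have pq: "p < a * b" "q < a * b" by auto
      note dm = div_mod_less[OF pq(1)] div_mod_less[OF pq(2)]
      have "X $$ (p div b * b + p mod b, q div b * b + q mod b)
          = (if p mod b = q mod b then x $$ (p div b, q div b) else 0)"
        using dm by (intro X_index) auto
      then have "X $$ (p, q) = (if p mod b = q mod b \<and> p div b = q div b then c else 0)"
        using dm by (simp add: c)
      moreover have "p mod b = q mod b \<and> p div b = q div b \<longleftrightarrow> p = q"
        by (metis div_mult_mod_eq)
      ultimately show "X $$ (p, q) = (c \<cdot>\<^sub>m 1\<^sub>m (a * b)) $$ (p, q)" using pq by simp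
    qed (use X in auto)
    then show "\<exists>c. X = c \<cdot>\<^sub>m 1\<^sub>m (a * b)" by blast
  qed
qed

section \<open>The Pauli group of one qubit\<close>

definition mat2 :: "complex \<Rightarrow> complex \<Rightarrow> complex \<Rightarrow> complex \<Rightarrow> complex mat" where
  "mat2 a b c d = mat 2 2 (\<lambda>(i, j). if i = 0 then if j = 0 then a else b else if j = 0 then c else d)"

lemma mat2_carrier: "mat2 a b c d \<in> carrier_mat 2 2"
  by (simp add: mat2_def)

lemma mat2_eqI:
  assumes "X \<in> carrier_mat 2 2" "X $$ (0, 0) = a" "X $$ (0, 1) = b" "X $$ (1, 0) = c" "X $$ (1, 1) = d"
  shows "X = mat2 a b c d"
proof (rule eq_matI)
  fix i j assume "i < dim_row (mat2 a b c d)" "j < dim_col (mat2 a b c d)"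
  then have "i < 2" "j < 2" by (auto simp: mat2_def)
  then show "X $$ (i, j) = mat2 a b c d $$ (i, j)"
    using assms by (auto simp: mat2_def less_2_cases_iff)
qed (use assms in \<open>auto simp: mat2_def\<close>)

lemma mat2_simps:
  "mat2 a b c d $$ (0, 0) = a" "mat2 a b c d $$ (0, Suc 0) = b"
  "mat2 a b c d $$ (Suc 0, 0) = c" "mat2 a b c d $$ (Suc 0, Suc 0) = d"
  "dim_row (mat2 a b c d) = 2" "dim_col (mat2 a b c d) = 2"
  by (auto simp: mat2_def)

lemma mat2_mult:
  "mat2 a b c d * mat2 a' b' c' d' = mat2 (a * a' + b * c') (a * b' + b * d') (c * a' + d * c') (c * b' + d * d')"
  by (rule mat2_eqI)
    (auto intro!: mult_carrier_mat[OF mat2_carrier mat2_carrier]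
      simp: index_mat_mult mat2_simps numeral_2_eq_2 simp del: index_mult_mat(1))

lemma mat2_adjoint: "mat_adjoint (mat2 a b c d) = mat2 (cnj a) (cnj c) (cnj b) (cnj d)"
  by (rule mat2_eqI) (auto simp: mat2_carrier mat2_simps)

lemma mat2_smult: "x \<cdot>\<^sub>m mat2 a b c d = mat2 (x * a) (x * b) (x * c) (x * d)"
  by (rule mat2_eqI) (auto simp: mat2_carrier mat2_simps)

lemma mat2_one: "1\<^sub>m 2 = mat2 1 0 0 1"
  by (rule mat2_eqI) auto

lemma mat2_eq_iff: "mat2 a b c d = mat2 a' b' c' d' \<longleftrightarrow> a = a' \<and> b = b' \<and> c = c' \<and> d = d'"
  by (metis mat2_simps(1-4))

text \<open>The 16 phase multiples of the Pauli matrices, sorted by shape: the diagonal ones are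
  multiples of I or Z, the others of X or Y. With a free phase \<open>a\<close> and a relative sign
  \<open>s\<close>, closure under products takes only four cases.\<close>

definition qubit_paulis :: "complex mat set" where
  "qubit_paulis = {mat2 a 0 0 (s * a) | a s. a \<in> {1, - 1, \<i>, - \<i>} \<and> s \<in> {1, - 1}} \<union>
    {mat2 0 a (s * a) 0 | a s. a \<in> {1, - 1, \<i>, - \<i>} \<and> s \<in> {1, - 1}}"

lemma qubit_paulis_cases:
  assumes "A \<in> qubit_paulis"
  obtains a s where "A = mat2 a 0 0 (s * a) \<or> A = mat2 0 a (s * a) 0" "a \<in> {1, - 1, \<i>, - \<i>}" "s \<in> {1, - 1}"
  using assms unfolding qubit_paulis_def by blast

lemma qubit_paulisI:
  assumes "a \<in> {1, - 1, \<i>, - \<i>}" "s \<in> {1, - 1}"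
  shows "mat2 a 0 0 (s * a) \<in> qubit_paulis" "mat2 0 a (s * a) 0 \<in> qubit_paulis"
  using assms unfolding qubit_paulis_def by blast+

lemma paulis_in_qubit_paulis: "{1\<^sub>m 2, pauli_X, pauli_Y, pauli_Z} \<subseteq> qubit_paulis"
proof -
  have "pauli_X = mat2 0 1 1 0" "pauli_Y = mat2 0 (- \<i>) \<i> 0" "pauli_Z = mat2 1 0 0 (- 1)"
    by (auto intro!: mat2_eqI simp: pauli_X_def pauli_Y_def pauli_Z_def mat_of_rows_list_def)
  then show ?thesis
    using qubit_paulisI(1)[of 1 1] qubit_paulisI(1)[of 1 "- 1"] qubit_paulisI(2)[of 1 1] qubit_paulisI(2)[of "- \<i>" "- 1"]
    by (simp add: mat2_one)
qed

lemma error_group_qubit_paulis: "error_group 2 qubit_paulis"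
proof
  show "finite qubit_paulis"
    unfolding qubit_paulis_def by (intro finite_UnI finite_image_set2) auto
  show "1\<^sub>m 2 \<in> qubit_paulis" using paulis_in_qubit_paulis by blast
next
  fix A assume "A \<in> qubit_paulis"
  then show "A \<in> carrier_mat 2 2" "A * mat_adjoint A = 1\<^sub>m 2" "mat_adjoint A = A \<or> mat_adjoint A = - 1 \<cdot>\<^sub>m A"
    by (elim qubit_paulis_cases; auto simp: mat2_carrier mat2_adjoint mat2_mult mat2_smult mat2_one mat2_eq_iff)+
next
  fix A B assume A: "A \<in> qubit_paulis" and B: "B \<in> qubit_paulis"
  obtain a s where as: "A = mat2 a 0 0 (s * a) \<or> A = mat2 0 a (s * a) 0" "a \<in> {1, - 1, \<i>, - \<i>}" "s \<in> {1, - 1}"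
    using A by (rule qubit_paulis_cases)
  obtain b t where bt: "B = mat2 b 0 0 (t * b) \<or> B = mat2 0 b (t * b) 0" "b \<in> {1, - 1, \<i>, - \<i>}" "t \<in> {1, - 1}"
    using B by (rule qubit_paulis_cases)
  have ab: "a * b \<in> {1, - 1, \<i>, - \<i>}" "t * (a * b) \<in> {1, - 1, \<i>, - \<i>}" "s * t \<in> {1, - 1}" "t * t = 1" "s * s = 1"
    using as(2,3) bt(2,3) by auto
  note D = qubit_paulisI(1) and O = qubit_paulisI(2)
  consider "A = mat2 a 0 0 (s * a)" "B = mat2 b 0 0 (t * b)" | "A = mat2 a 0 0 (s * a)" "B = mat2 0 b (t * b) 0"
    | "A = mat2 0 a (s * a) 0" "B = mat2 b 0 0 (t * b)" | "A = mat2 0 a (s * a) 0" "B = mat2 0 b (t * b) 0"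
    using as(1) bt(1) by blast
  then show "A * B \<in> qubit_paulis"
  proof cases
    case 1
    then show ?thesis using D[OF ab(1,3)] by (simp add: mat2_mult mult_ac)
  next
    case 2
    then show ?thesis using O[OF ab(1,3)] by (simp add: mat2_mult mult_ac)
  next
    case 3
    have eq: "(s * t) * (t * (a * b)) = s * (a * b)" using ab(4) by (simp add: algebra_simps)
    have "A * B = mat2 0 (t * (a * b)) ((s * t) * (t * (a * b))) 0"
      unfolding eq by (simp add: 3 mat2_mult mult_ac)
    then show ?thesis using O[OF ab(2,3)] by simp
  next
    case 4
    have eq: "(s * t) * (t * (a * b)) = s * (a * b)" using ab(4) by (simp add: algebra_simps)
    have "A * B = mat2 (t * (a * b)) 0 0 ((s * t) * (t * (a * b)))"
      unfolding eq by (simp add: 4 mat2_mult mult_ac)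
    then show ?thesis using D[OF ab(2,3)] by simp
  qed
  show "A * B = B * A \<or> A * B = - 1 \<cdot>\<^sub>m (B * A)"
    using as bt by (elim disjE; simp add: mat2_mult mat2_smult mat2_eq_iff; auto)
next
  fix X :: "complex mat"
  assume X: "X \<in> carrier_mat 2 2" and comm: "\<And>A. A \<in> qubit_paulis \<Longrightarrow> A * X = X * A"
  obtain a b c d where X_eq: "X = mat2 a b c d" using mat2_eqI[OF X refl refl refl refl] by blast
  \<comment> \<open>Commuting with Z kills the off-diagonal entries; commuting with X makes the
    diagonal constant.\<close>
  have "mat2 1 0 0 (- 1 * 1) \<in> qubit_paulis" "mat2 0 1 (1 * 1) 0 \<in> qubit_paulis"
    by (intro qubit_paulisI; simp)+
  from comm[OF this(1)] comm[OF this(2)]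
  have "mat2 a b (- c) (- d) = mat2 a (- b) c (- d)" "mat2 c d a b = mat2 b a d c"
    by (simp_all add: X_eq mat2_mult)
  then have eqs: "b = - b" "- c = c" "d = a" unfolding mat2_eq_iff by blast+
  then have "b = 0" "c = 0" by simp_all
  with eqs(3) have "X = a \<cdot>\<^sub>m 1\<^sub>m 2"
    by (simp add: X_eq mat2_smult mat2_one)
  then show "\<exists>c. X = c \<cdot>\<^sub>m 1\<^sub>m 2" by blast
qed simp

lemma pauli_group_in_error_group: "\<exists>G. error_group (2 ^ n) G \<and> pauli_group n \<subseteq> G"
proof (induction n)
  case 0
  define G where "G = (\<lambda>c. c \<cdot>\<^sub>m 1\<^sub>m 1) ` {1, - 1, \<i>, - \<i> :: complex}"
  have "error_group 1 G"
  proof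
    fix X :: "complex mat" assume "X \<in> carrier_mat 1 1"
    then have "X = X $$ (0, 0) \<cdot>\<^sub>m 1\<^sub>m 1" by (intro eq_matI) auto
    then show "\<exists>c. X = c \<cdot>\<^sub>m 1\<^sub>m 1" by blast
  next
    show "1\<^sub>m 1 \<in> G" unfolding G_def by (rule image_eqI[of _ _ 1]) auto
  next
    fix A B assume "A \<in> G" "B \<in> G"
    then obtain a b where "A = a \<cdot>\<^sub>m 1\<^sub>m 1" "B = b \<cdot>\<^sub>m 1\<^sub>m 1" "a \<in> {1, - 1, \<i>, - \<i>}" "b \<in> {1, - 1, \<i>, - \<i>}"
      unfolding G_def by blast
    moreover from this have "A * B = (a * b) \<cdot>\<^sub>m 1\<^sub>m 1" "B * A = (a * b) \<cdot>\<^sub>m 1\<^sub>m 1" "a * b \<in> {1, - 1, \<i>, - \<i>}"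
      by (auto simp: mat_mult_simps)
    ultimately show "A * B \<in> G" "A * B = B * A \<or> A * B = - 1 \<cdot>\<^sub>m (B * A)"
      unfolding G_def by auto
  next
    fix A assume "A \<in> G"
    then show "A * mat_adjoint A = 1\<^sub>m 1" "mat_adjoint A = A \<or> mat_adjoint A = - 1 \<cdot>\<^sub>m A"
      unfolding G_def by (auto simp: mat_adjoint_smult mat_mult_simps)
  qed (auto simp: G_def)
  moreover have "pauli_group 0 \<subseteq> G"
    by (auto simp: pauli_group_def G_def tensor_list_def)
  ultimately show ?case by auto
next
  case (Suc n)
  then obtain G where G: "error_group (2 ^ n) G" "pauli_group n \<subseteq> G" by blast
  have "pauli_group (Suc n) \<subseteq> {kron A B | A B. A \<in> qubit_paulis \<and> B \<in> G}"
  proof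
    fix P assume "P \<in> pauli_group (Suc n)"
    then obtain c Ps where "P = c \<cdot>\<^sub>m tensor_list Ps" "c \<in> {1, - 1, \<i>, - \<i>}" "length Ps = Suc n"
      "set Ps \<subseteq> {1\<^sub>m 2, pauli_X, pauli_Y, pauli_Z}"
      unfolding pauli_group_def by blast
    moreover from this obtain Q Qs where "Ps = Q # Qs" by (cases Ps) auto
    ultimately obtain c Q Qs where P: "P = c \<cdot>\<^sub>m tensor_list (Q # Qs)" "c \<in> {1, - 1, \<i>, - \<i>}" "length Qs = n"
      "Q \<in> {1\<^sub>m 2, pauli_X, pauli_Y, pauli_Z}" "set Qs \<subseteq> {1\<^sub>m 2, pauli_X, pauli_Y, pauli_Z}"
      by simp
    \<comment> \<open>The phase moves into the tail, and finally into the base case, whose group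
      consists of the four phases.\<close>
    have "P = kron Q (c \<cdot>\<^sub>m tensor_list Qs)"
      unfolding P(1) by (simp add: tensor_list_def kron_smult_right)
    moreover have "c \<cdot>\<^sub>m tensor_list Qs \<in> G"
      using G(2) P unfolding pauli_group_def by blast
    moreover have "Q \<in> qubit_paulis" using P(4) paulis_in_qubit_paulis by blast
    ultimately show "P \<in> {kron A B | A B. A \<in> qubit_paulis \<and> B \<in> G}" by blast
  qed
  then show ?case using error_group_kron[OF error_group_qubit_paulis G(1)] by auto
qed

section \<open>Protocols\<close>

lemma dim_sandwich [simp]: "dim_row (sandwich K \<rho>) = dim_row K" "dim_col (sandwich K \<rho>) = dim_row K"
  by (simp_all add: sandwich_def)

lemma sandwich_sandwich:
  assumes "dim_col A = dim_row B" "dim_row \<rho> = dim_col B" "dim_col \<rho> = dim_col B"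
  shows "sandwich A (sandwich B \<rho>) = sandwich (A * B) \<rho>"
  using assms by (simp add: sandwich_def mat_adjoint_mult mult_assoc_mat)

lemma sandwich_smult:
  assumes "dim_row \<rho> = dim_col K" "dim_col \<rho> = dim_col K"
  shows "sandwich K (c \<cdot>\<^sub>m \<rho>) = c \<cdot>\<^sub>m sandwich K \<rho>"
    "sandwich (c \<cdot>\<^sub>m K) \<rho> = (c * cnj c) \<cdot>\<^sub>m sandwich K \<rho>"
  using assms by (simp_all add: sandwich_def mat_adjoint_smult mat_mult_simps mult.commute)

lemma sandwich_zero: "dim_col K = n \<Longrightarrow> sandwich K (0\<^sub>m n n) = 0\<^sub>m (dim_row K) (dim_row K)"
  by (simp add: sandwich_def)

lemma dim_pure_state [simp]: "dim_row (pure_state v) = dim_vec v" "dim_col (pure_state v) = dim_vec v"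
  by (simp_all add: pure_state_def)

lemma sandwich_pure_state:
  assumes "dim_col K = dim_vec v"
  shows "sandwich K (pure_state v) = pure_state (K *\<^sub>v v)"
proof (rule eq_matI)
  fix i j assume "i < dim_row (pure_state (K *\<^sub>v v))" "j < dim_col (pure_state (K *\<^sub>v v))"
  then have ij: "i < dim_row K" "j < dim_row K" by auto
  have "sandwich K (pure_state v) $$ (i, j)
      = (\<Sum>q<dim_vec v. (\<Sum>p<dim_vec v. K $$ (i, p) * (v $ p * cnj (v $ q))) * cnj (K $$ (j, q)))"
    using ij assms by (simp add: sandwich_def index_mat_mult del: index_mult_mat(1)) (simp add: pure_state_def)
  also have "\<dots> = (\<Sum>p<dim_vec v. K $$ (i, p) * v $ p) * (\<Sum>q<dim_vec v. cnj (K $$ (j, q) * v $ q))"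
    by (simp add: sum_distrib_right sum_distrib_left mult_ac)
  also have "\<dots> = pure_state (K *\<^sub>v v) $$ (i, j)"
    using ij assms by (simp add: pure_state_def index_mat_mult_vec del: index_mult_mat_vec)
  finally show "sandwich K (pure_state v) $$ (i, j) = pure_state (K *\<^sub>v v) $$ (i, j)" .
qed simp_all

lemma pure_state_smult: "pure_state (c \<cdot>\<^sub>v v) = (c * cnj c) \<cdot>\<^sub>m pure_state v"
  by (rule eq_matI) (auto simp: pure_state_def)

section \<open>Maximally entangled states\<close>

lemma dim_epr_pairs [simp]: "dim_vec (epr_pairs k) = 2 ^ k * 2 ^ k"
  by (simp add: epr_pairs_def)

lemma epr_pairs_index':
  assumes "i < 2 ^ k * 2 ^ k"
  shows "epr_pairs k $ i = (if i div 2 ^ k = i mod 2 ^ k then 1 / complex_of_real (sqrt 2) ^ k else 0)"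
  using epr_pairs_index[of "i div 2 ^ k" k "i mod 2 ^ k"] div_mod_less[OF assms]
  unfolding div_mult_mod_eq by blast

lemma trace_epr_pairs: "trace_mat (pure_state (epr_pairs k)) = 1"
proof -
  define \<alpha> where "\<alpha> = 1 / complex_of_real (sqrt 2) ^ k"
  have "trace_mat (pure_state (epr_pairs k))
      = (\<Sum>i<2 ^ k * 2 ^ k :: nat. if i div 2 ^ k = i mod 2 ^ k then \<alpha> * cnj \<alpha> else 0)"
    by (auto simp: trace_mat_def pure_state_def epr_pairs_index' \<alpha>_def intro!: sum.cong)
  also have "\<dots> = (\<Sum>i<2 ^ k :: nat. \<Sum>j<2 ^ k :: nat. if i = j then \<alpha> * cnj \<alpha> else 0)"
    by (rule sum_div_mod)
  also have "\<dots> = 2 ^ k * (\<alpha> * cnj \<alpha>)" by simp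
  also have "\<alpha> * cnj \<alpha> = 1 / 2 ^ k"
    by (simp add: \<alpha>_def flip: of_real_mult power_mult_distrib)
  finally show ?thesis by simp
qed

text \<open>The transpose trick for rectangular \<open>K\<close>: the coordinates of both vectors
  are the entries of \<open>K\<close> up to a constant, and \<open>c\<close> compensates for the
  different normalizations of \<open>n\<close> and \<open>m\<close> pairs.\<close>

lemma kron_transpose_epr_pairs:
  assumes K: "K \<in> carrier_mat (2 ^ m) (2 ^ n)"
  shows "\<exists>c. kron K (1\<^sub>m (2 ^ n)) *\<^sub>v epr_pairs n = c \<cdot>\<^sub>v (kron (1\<^sub>m (2 ^ m)) (transpose_mat K) *\<^sub>v epr_pairs m)"
proof -
  have dimK: "dim_row K = 2 ^ m" "dim_col K = 2 ^ n" using K by auto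
  define \<alpha> \<beta> where "\<alpha> = 1 / complex_of_real (sqrt 2) ^ n" and "\<beta> = 1 / complex_of_real (sqrt 2) ^ m"
  have \<beta>: "\<beta> \<noteq> 0" by (simp add: \<beta>_def)
  have "kron K (1\<^sub>m (2 ^ n)) *\<^sub>v epr_pairs n = (\<alpha> / \<beta>) \<cdot>\<^sub>v (kron (1\<^sub>m (2 ^ m)) (transpose_mat K) *\<^sub>v epr_pairs m)"
  proof (rule eq_vecI)
    fix i assume "i < dim_vec ((\<alpha> / \<beta>) \<cdot>\<^sub>v (kron (1\<^sub>m (2 ^ m)) (transpose_mat K) *\<^sub>v epr_pairs m))"
    then have i: "i < 2 ^ m * 2 ^ n" by (simp add: dimK)
    define x y where "x = i div 2 ^ n" and "y = i mod 2 ^ n"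
    have xy: "x < 2 ^ m" "y < 2 ^ n" using div_mod_less[OF i] by (auto simp: x_def y_def)
    have "(kron K (1\<^sub>m (2 ^ n)) *\<^sub>v epr_pairs n) $ i
        = (\<Sum>p<2 ^ n * 2 ^ n. K $$ (x, p div 2 ^ n) * (if y = p mod 2 ^ n then 1 else 0)
            * (if p div 2 ^ n = p mod 2 ^ n then \<alpha> else 0))"
      using i xy by (subst index_mat_mult_vec)
        (auto simp: dimK index_kron epr_pairs_index' \<alpha>_def x_def y_def div_mod_less intro!: sum.cong)
    also have "\<dots> = (\<Sum>p<2 ^ n. \<Sum>q<2 ^ n. K $$ (x, p) * (if y = q then 1 else 0) * (if p = q then \<alpha> else 0))"
      by (rule sum_div_mod)
    also have "\<dots> = (\<Sum>p<2 ^ n. \<Sum>q<2 ^ n. if p = q then (if y = p then K $$ (x, p) * \<alpha> else 0) else 0)"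
      by (intro sum.cong) auto
    also have "\<dots> = K $$ (x, y) * \<alpha>" using xy by simp
    finally have L: "(kron K (1\<^sub>m (2 ^ n)) *\<^sub>v epr_pairs n) $ i = K $$ (x, y) * \<alpha>" .
    have "(kron (1\<^sub>m (2 ^ m)) (transpose_mat K) *\<^sub>v epr_pairs m) $ i
        = (\<Sum>p<2 ^ m * 2 ^ m. (if x = p div 2 ^ m then 1 else 0) * K $$ (p mod 2 ^ m, y)
            * (if p div 2 ^ m = p mod 2 ^ m then \<beta> else 0))"
      using i xy by (subst index_mat_mult_vec)
        (auto simp: dimK index_kron epr_pairs_index' \<beta>_def x_def y_def div_mod_less intro!: sum.cong)
    also have "\<dots> = (\<Sum>p<2 ^ m. \<Sum>q<2 ^ m. (if x = p then 1 else 0) * K $$ (q, y) * (if p = q then \<beta> else 0))"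
      by (rule sum_div_mod)
    also have "\<dots> = (\<Sum>p<2 ^ m. \<Sum>q<2 ^ m. if p = q then (if x = p then K $$ (p, y) * \<beta> else 0) else 0)"
      by (intro sum.cong) auto
    also have "\<dots> = K $$ (x, y) * \<beta>" using xy by simp
    finally have R: "(kron (1\<^sub>m (2 ^ m)) (transpose_mat K) *\<^sub>v epr_pairs m) $ i = K $$ (x, y) * \<beta>" .
    show "(kron K (1\<^sub>m (2 ^ n)) *\<^sub>v epr_pairs n) $ i
        = ((\<alpha> / \<beta>) \<cdot>\<^sub>v (kron (1\<^sub>m (2 ^ m)) (transpose_mat K) *\<^sub>v epr_pairs m)) $ i"
      using i R \<beta> by (subst L) (simp add: dimK)
  qed (simp add: dimK)
  then show ?thesis by blast
qed

lemma dim_noisy_epr_pairs [simp]: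
  "dim_row P = 2 ^ n \<Longrightarrow> dim_row (noisy_epr_pairs n P) = 2 ^ n * 2 ^ n"
  "dim_row P = 2 ^ n \<Longrightarrow> dim_col (noisy_epr_pairs n P) = 2 ^ n * 2 ^ n"
  by (simp_all add: noisy_epr_pairs_def)

lemma noisy_epr_pairs_smult:
  "P \<in> carrier_mat (2 ^ n) (2 ^ n) \<Longrightarrow> noisy_epr_pairs n (c \<cdot>\<^sub>m P) = (c * cnj c) \<cdot>\<^sub>m noisy_epr_pairs n P"
  by (auto simp: noisy_epr_pairs_def kron_smult_right sandwich_smult)

text \<open>Alice's map is the complex conjugate of \<open>L\<close>. The transpose trick turns it
  into \<open>mat_adjoint L\<close> on Bob's side, acting before the error.\<close>

lemma measured_noisy_epr_pairs:
  assumes L: "L \<in> carrier_mat (2 ^ m) (2 ^ n)" "L' \<in> carrier_mat (2 ^ m) (2 ^ n)" and P: "P \<in> carrier_mat (2 ^ n) (2 ^ n)"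
  shows "\<exists>c. sandwich (kron (1\<^sub>m (2 ^ m)) L') (sandwich (kron (transpose_mat (mat_adjoint L)) (1\<^sub>m (2 ^ n))) (noisy_epr_pairs n P))
    = c \<cdot>\<^sub>m noisy_epr_pairs m (L' * (P * mat_adjoint L))"
proof -
  define K where "K = transpose_mat (mat_adjoint L)"
  have K: "K \<in> carrier_mat (2 ^ m) (2 ^ n)" using L by (simp add: K_def)
  have dims: "dim_row K = 2 ^ m" "dim_col K = 2 ^ n" "dim_row L = 2 ^ m" "dim_col L = 2 ^ n"
    "dim_row L' = 2 ^ m" "dim_col L' = 2 ^ n" "dim_row P = 2 ^ n" "dim_col P = 2 ^ n"
    using L P K by auto
  obtain c where c: "kron K (1\<^sub>m (2 ^ n)) *\<^sub>v epr_pairs n = c \<cdot>\<^sub>v (kron (1\<^sub>m (2 ^ m)) (mat_adjoint L) *\<^sub>v epr_pairs m)"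
    using kron_transpose_epr_pairs[OF K] by (auto simp: K_def)
  have "sandwich (kron (1\<^sub>m (2 ^ m)) L') (sandwich (kron K (1\<^sub>m (2 ^ n))) (noisy_epr_pairs n P))
      = sandwich (kron K (L' * P)) (pure_state (epr_pairs n))"
    by (simp add: noisy_epr_pairs_def sandwich_sandwich kron_mult dims)
  also have "\<dots> = sandwich (kron (1\<^sub>m (2 ^ m)) (L' * P)) (sandwich (kron K (1\<^sub>m (2 ^ n))) (pure_state (epr_pairs n)))"
    by (simp add: sandwich_sandwich kron_mult dims)
  also have "sandwich (kron K (1\<^sub>m (2 ^ n))) (pure_state (epr_pairs n))
      = (c * cnj c) \<cdot>\<^sub>m sandwich (kron (1\<^sub>m (2 ^ m)) (mat_adjoint L)) (pure_state (epr_pairs m))"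
    by (simp add: sandwich_pure_state dims c pure_state_smult)
  also have "sandwich (kron (1\<^sub>m (2 ^ m)) (L' * P)) \<dots>
      = (c * cnj c) \<cdot>\<^sub>m noisy_epr_pairs m (L' * (P * mat_adjoint L))"
    by (simp add: sandwich_smult sandwich_sandwich kron_mult dims noisy_epr_pairs_def mult_assoc_mat)
  finally show ?thesis unfolding K_def by blast
qed

section \<open>Branches of a protocol and recovery up to scalars\<close>

lemma sum_mats_carrier:
  "(\<And>A. A \<in> set As \<Longrightarrow> A \<in> carrier_mat r c) \<Longrightarrow> sum_mats r c As \<in> carrier_mat r c"
  by (induction As) (auto simp: sum_mats_def)

lemma sum_mats_zero: "(\<And>A. A \<in> set As \<Longrightarrow> A = 0\<^sub>m r c) \<Longrightarrow> sum_mats r c As = 0\<^sub>m r c"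
proof (induction As)
  case (Cons A As)
  then have "A = 0\<^sub>m r c" "sum_mats r c As = 0\<^sub>m r c" by simp_all
  then show ?case by (simp add: sum_mats_def)
qed (simp add: sum_mats_def)

lemma sum_mats_singleton: "A \<in> carrier_mat r c \<Longrightarrow> sum_mats r c [A] = A"
  by (simp add: sum_mats_def)

lemma sum_mats_index:
  assumes "\<And>A. A \<in> set As \<Longrightarrow> A \<in> carrier_mat r c" "i < r" "j < c"
  shows "sum_mats r c As $$ (i, j) = (\<Sum>A\<leftarrow>As. A $$ (i, j))"
  using assms(1)
proof (induction As)
  case (Cons A As)
  then have "sum_mats r c As \<in> carrier_mat r c" "A \<in> carrier_mat r c" by (auto intro: sum_mats_carrier)
  then show ?case using Cons assms(2,3) by (auto simp: sum_mats_def)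
qed (use assms in \<open>simp add: sum_mats_def\<close>)

text \<open>Impossible outcomes still count as branches of \<open>final_states\<close>. By linearity
  they carry the zero matrix to the end, whatever the parties do.\<close>

lemma final_states_zero:
  "locc k \<pi> a b \<Longrightarrow> \<sigma> \<in> final_states \<pi> a b (0\<^sub>m (a * b) (a * b)) \<Longrightarrow> \<sigma> = 0\<^sub>m (2 ^ k * 2 ^ k) (2 ^ k * 2 ^ k)"
proof (induction \<pi> arbitrary: a b)
  case (AliceOp d Ks f)
  then obtain m where m: "m < length Ks" "locc k (f m) d b"
    "\<sigma> \<in> final_states (f m) d b (sum_mats (d * b) (d * b) (map (\<lambda>K. sandwich (kron K (1\<^sub>m b)) (0\<^sub>m (a * b) (a * b))) (Ks ! m)))"
    by auto
  have K: "K \<in> carrier_mat d a" if "K \<in> set (Ks ! m)" for K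
    using AliceOp.prems(1) that m(1) by (auto simp: is_instrument_def)
  have "dim_row K = d" "dim_col K = a" if "K \<in> set (Ks ! m)" for K
    using K[OF that] by auto
  then have "sum_mats (d * b) (d * b) (map (\<lambda>K. sandwich (kron K (1\<^sub>m b)) (0\<^sub>m (a * b) (a * b))) (Ks ! m)) = 0\<^sub>m (d * b) (d * b)"
    by (intro sum_mats_zero) (auto simp: sandwich_zero)
  then show ?case using AliceOp.IH[of "f m" d b] m by auto
next
  case (BobOp d Ks f)
  then obtain m where m: "m < length Ks" "locc k (f m) a d"
    "\<sigma> \<in> final_states (f m) a d (sum_mats (a * d) (a * d) (map (\<lambda>K. sandwich (kron (1\<^sub>m a) K) (0\<^sub>m (a * b) (a * b))) (Ks ! m)))"
    by auto
  have K: "K \<in> carrier_mat d b" if "K \<in> set (Ks ! m)" for K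
    using BobOp.prems(1) that m(1) by (auto simp: is_instrument_def)
  have "dim_row K = d" "dim_col K = b" if "K \<in> set (Ks ! m)" for K
    using K[OF that] by auto
  then have "sum_mats (a * d) (a * d) (map (\<lambda>K. sandwich (kron (1\<^sub>m a) K) (0\<^sub>m (a * b) (a * b))) (Ks ! m)) = 0\<^sub>m (a * d) (a * d)"
    by (intro sum_mats_zero) (auto simp: sandwich_zero)
  then show ?case using BobOp.IH[of "f m" a d] m by auto
qed auto

text \<open>The linear form of \<open>corrects\<close>, suited to induction: \<open>c\<close>
  absorbs the weights of earlier outcomes and scalars in the error, and \<open>d\<close> may be
  0.\<close>

definition recovers :: "nat \<Rightarrow> protocol \<Rightarrow> nat \<Rightarrow> complex mat \<Rightarrow> bool" where
  "recovers k \<pi> n P \<longleftrightarrow> (\<forall>c. \<forall>\<sigma>\<in>final_states \<pi> (2 ^ n) (2 ^ n) (c \<cdot>\<^sub>m noisy_epr_pairs n P).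
     \<exists>d. \<sigma> = d \<cdot>\<^sub>m pure_state (epr_pairs k))"

lemma recovers_smult:
  "recovers k \<pi> n P \<Longrightarrow> P \<in> carrier_mat (2 ^ n) (2 ^ n) \<Longrightarrow> recovers k \<pi> n (u \<cdot>\<^sub>m P)"
  unfolding recovers_def using noisy_epr_pairs_smult[of P n u] by (metis smult_smult_mat)

lemma corrects_if_recovers:
  assumes "\<And>P. P \<in> E \<Longrightarrow> recovers k \<pi> n P"
  shows "corrects n k \<pi> E"
  unfolding corrects_def
proof (intro ballI impI)
  fix P \<sigma> assume P: "P \<in> E" and \<sigma>: "\<sigma> \<in> final_states \<pi> (2 ^ n) (2 ^ n) (noisy_epr_pairs n P)" "trace_mat \<sigma> \<noteq> 0"
  then obtain d where d: "\<sigma> = d \<cdot>\<^sub>m pure_state (epr_pairs k)"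
    using assms[OF P] unfolding recovers_def by (metis one_smult_mat)
  then have "trace_mat \<sigma> = d" by (simp add: trace_mat_smult trace_epr_pairs)
  with \<sigma>(2) show "(1 / trace_mat \<sigma>) \<cdot>\<^sub>m \<sigma> = pure_state (epr_pairs k)"
    by (simp add: d smult_smult_mat)
qed

text \<open>With only one candidate left, Bob simply applies its inverse.\<close>

lemma single_error_protocol:
  assumes P: "P \<in> carrier_mat (2 ^ k) (2 ^ k)" "P * mat_adjoint P = 1\<^sub>m (2 ^ k)" "mat_adjoint P * P = 1\<^sub>m (2 ^ k)"
  shows "\<exists>\<pi>. locc k \<pi> (2 ^ k) (2 ^ k) \<and> recovers k \<pi> k P"
proof -
  define \<pi> where "\<pi> = BobOp (2 ^ k) [[mat_adjoint P]] (\<lambda>_. Output)"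
  have dimP: "dim_row P = 2 ^ k" "dim_col P = 2 ^ k" using P by auto
  have "locc k \<pi> (2 ^ k) (2 ^ k)"
    using P by (simp add: \<pi>_def is_instrument_def sum_mats_def)
  moreover have "recovers k \<pi> k P"
    unfolding recovers_def
  proof (intro allI ballI)
    fix c \<sigma> assume "\<sigma> \<in> final_states \<pi> (2 ^ k) (2 ^ k) (c \<cdot>\<^sub>m noisy_epr_pairs k P)"
    then have "\<sigma> = sandwich (kron (1\<^sub>m (2 ^ k)) (mat_adjoint P)) (c \<cdot>\<^sub>m noisy_epr_pairs k P)"
      by (simp add: \<pi>_def sum_mats_singleton carrier_matI dimP lessThan_Suc)
    also have "\<dots> = c \<cdot>\<^sub>m sandwich (kron (1\<^sub>m (2 ^ k)) (1\<^sub>m (2 ^ k))) (pure_state (epr_pairs k))"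
      by (simp add: noisy_epr_pairs_def sandwich_smult sandwich_sandwich kron_mult dimP P(3))
    also have "\<dots> = c \<cdot>\<^sub>m pure_state (epr_pairs k)"
      unfolding kron_one by (subst sandwich_pure_state) (auto simp: carrier_vecI one_mult_mat_vec)
    finally show "\<exists>d. \<sigma> = d \<cdot>\<^sub>m pure_state (epr_pairs k)" by blast
  qed
  ultimately show ?thesis by blast
qed

text \<open>Alice uses the complex conjugates of Bob's maps, as the transpose trick requires.
  Outcome 0 stands for \<open>False\<close> and 1 for \<open>True\<close>. The continuation is told
  only whether the outcomes agree, since the residual error is the same in both agreeing and in both
  disagreeing branches.\<close>

definition measure_pairs :: "nat \<Rightarrow> (bool \<Rightarrow> complex mat) \<Rightarrow> (bool \<Rightarrow> protocol) \<Rightarrow> protocol" where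
  "measure_pairs m L \<pi> =
     AliceOp (2 ^ m) (map (\<lambda>b. [transpose_mat (mat_adjoint (L b))]) [False, True]) (\<lambda>i.
     BobOp (2 ^ m) (map (\<lambda>b. [L b]) [False, True]) (\<lambda>j. \<pi> (i = j)))"

text \<open>For the conjugated maps, each product \<open>mat_adjoint (L b) * L b\<close> is replaced
  by its transpose, and the identity is symmetric.\<close>

lemma is_instrument_measure:
  assumes L: "\<And>b. L b \<in> carrier_mat d a"
    and complete: "mat_adjoint (L False) * L False + mat_adjoint (L True) * L True = 1\<^sub>m a"
  shows "is_instrument a d (map (\<lambda>b. [L b]) [False, True])"
    "is_instrument a d (map (\<lambda>b. [transpose_mat (mat_adjoint (L b))]) [False, True])"
proof -
  have c: "mat_adjoint (L b) * L b \<in> carrier_mat a a" for b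
    using L by (intro mult_carrier_mat[of _ a d]) auto
  show "is_instrument a d (map (\<lambda>b. [L b]) [False, True])"
    using L complete right_add_zero_mat[OF c] by (simp add: is_instrument_def sum_mats_def)
  have conj: "mat_adjoint (transpose_mat (mat_adjoint (L b))) * transpose_mat (mat_adjoint (L b))
      = transpose_mat (mat_adjoint (L b) * L b)" for b
  proof (rule eq_matI)
    have dims: "dim_row (L b) = d" "dim_col (L b) = a" using L[of b] by auto
    fix i j assume "i < dim_row (transpose_mat (mat_adjoint (L b) * L b))" "j < dim_col (transpose_mat (mat_adjoint (L b) * L b))"
    then have "i < a" "j < a" by (auto simp: dims)
    then show "(mat_adjoint (transpose_mat (mat_adjoint (L b))) * transpose_mat (mat_adjoint (L b))) $$ (i, j)
        = transpose_mat (mat_adjoint (L b) * L b) $$ (i, j)"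
      by (simp add: index_mat_mult dims mult.commute del: index_mult_mat(1))
  qed simp_all
  have "transpose_mat (mat_adjoint (L False) * L False) + transpose_mat (mat_adjoint (L True) * L True) = 1\<^sub>m a"
    unfolding transpose_add[OF c c, symmetric] complete by simp
  moreover have "transpose_mat (mat_adjoint (L True) * L True) \<in> carrier_mat a a" using c by simp
  ultimately show "is_instrument a d (map (\<lambda>b. [transpose_mat (mat_adjoint (L b))]) [False, True])"
    using L by (simp add: is_instrument_def sum_mats_def conj right_add_zero_mat)
qed

lemma locc_measure_pairs:
  assumes "\<And>b. L b \<in> carrier_mat (2 ^ m) (2 ^ n)"
    and "mat_adjoint (L False) * L False + mat_adjoint (L True) * L True = 1\<^sub>m (2 ^ n)"
    and "\<And>b. locc k (\<pi> b) (2 ^ m) (2 ^ m)"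
  shows "locc k (measure_pairs m L \<pi>) (2 ^ n) (2 ^ n)"
  using is_instrument_measure[OF assms(1,2)] assms(3) by (simp add: measure_pairs_def)

lemma final_states_measure_pairs:
  assumes L: "\<And>b. L b \<in> carrier_mat (2 ^ m) (2 ^ n)" and P: "P \<in> carrier_mat (2 ^ n) (2 ^ n)"
    and \<sigma>: "\<sigma> \<in> final_states (measure_pairs m L \<pi>) (2 ^ n) (2 ^ n) (c \<cdot>\<^sub>m noisy_epr_pairs n P)"
  shows "\<exists>b b' c'. \<sigma> \<in> final_states (\<pi> (b = b')) (2 ^ m) (2 ^ m)
    (c' \<cdot>\<^sub>m noisy_epr_pairs m (L b' * (P * mat_adjoint (L b))))"
proof -
  have dims: "dim_row (L b) = 2 ^ m" "dim_col (L b) = 2 ^ n" "dim_row P = 2 ^ n" "dim_col P = 2 ^ n" for b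
    using L[of b] P by auto
  define F where "F b b' = final_states (\<pi> (b = b')) (2 ^ m) (2 ^ m) (sandwich (kron (1\<^sub>m (2 ^ m)) (L b'))
      (sandwich (kron (transpose_mat (mat_adjoint (L b))) (1\<^sub>m (2 ^ n))) (c \<cdot>\<^sub>m noisy_epr_pairs n P)))" for b b'
  have "\<sigma> \<in> F False False \<or> \<sigma> \<in> F False True \<or> \<sigma> \<in> F True False \<or> \<sigma> \<in> F True True"
    using \<sigma> unfolding measure_pairs_def
    by (auto simp: F_def sum_mats_singleton carrier_matI dims lessThan_Suc numeral_2_eq_2)
  then obtain b b' where \<sigma>': "\<sigma> \<in> F b b'" by blast
  obtain c' where c': "sandwich (kron (1\<^sub>m (2 ^ m)) (L b'))
      (sandwich (kron (transpose_mat (mat_adjoint (L b))) (1\<^sub>m (2 ^ n))) (noisy_epr_pairs n P))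
      = c' \<cdot>\<^sub>m noisy_epr_pairs m (L b' * (P * mat_adjoint (L b)))"
    using measured_noisy_epr_pairs[OF L L P] by blast
  have "sandwich (kron (1\<^sub>m (2 ^ m)) (L b'))
      (sandwich (kron (transpose_mat (mat_adjoint (L b))) (1\<^sub>m (2 ^ n))) (c \<cdot>\<^sub>m noisy_epr_pairs n P))
      = (c * c') \<cdot>\<^sub>m noisy_epr_pairs m (L b' * (P * mat_adjoint (L b)))"
    by (simp add: sandwich_smult dims c' smult_smult_mat)
  with \<sigma>' show ?thesis unfolding F_def by metis
qed

text \<open>\<open>s\<close> is the comparison result that the error dictates. In branches with the
  other result the state is zero, so only \<open>\<pi> s\<close> has to cope with
  \<open>Q\<close>.\<close>

lemma recovers_measure_pairs:
  assumes L: "\<And>b. L b \<in> carrier_mat (2 ^ m) (2 ^ n)" and P: "P \<in> carrier_mat (2 ^ n) (2 ^ n)"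
    and Q: "Q \<in> carrier_mat (2 ^ m) (2 ^ m)"
    and branch: "\<And>b b'. \<exists>u. L b' * (P * mat_adjoint (L b)) = u \<cdot>\<^sub>m Q \<and> ((b = b') \<noteq> s \<longrightarrow> u = 0)"
    and locc: "\<And>b. locc k (\<pi> b) (2 ^ m) (2 ^ m)"
    and rec: "recovers k (\<pi> s) m Q"
  shows "recovers k (measure_pairs m L \<pi>) n P"
  unfolding recovers_def
proof (intro allI ballI)
  fix c \<sigma> assume "\<sigma> \<in> final_states (measure_pairs m L \<pi>) (2 ^ n) (2 ^ n) (c \<cdot>\<^sub>m noisy_epr_pairs n P)"
  from final_states_measure_pairs[OF L P this] obtain b b' c' where
    \<sigma>: "\<sigma> \<in> final_states (\<pi> (b = b')) (2 ^ m) (2 ^ m) (c' \<cdot>\<^sub>m noisy_epr_pairs m (L b' * (P * mat_adjoint (L b))))"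
    by blast
  obtain u where u: "L b' * (P * mat_adjoint (L b)) = u \<cdot>\<^sub>m Q" "(b = b') \<noteq> s \<longrightarrow> u = 0"
    using branch by blast
  have \<sigma>': "\<sigma> \<in> final_states (\<pi> (b = b')) (2 ^ m) (2 ^ m) ((c' * (u * cnj u)) \<cdot>\<^sub>m noisy_epr_pairs m Q)"
    using \<sigma> Q by (simp add: u(1) noisy_epr_pairs_smult smult_smult_mat)
  show "\<exists>d. \<sigma> = d \<cdot>\<^sub>m pure_state (epr_pairs k)"
  proof (cases "(b = b') = s")
    case True
    then show ?thesis using rec \<sigma>' unfolding recovers_def by auto
  next
    case False
    then have "u = 0" using u(2) by blast
    with \<sigma>' Q have "\<sigma> \<in> final_states (\<pi> (b = b')) (2 ^ m) (2 ^ m) (0\<^sub>m (2 ^ m * 2 ^ m) (2 ^ m * 2 ^ m))"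
      by auto
    then have "\<sigma> = 0 \<cdot>\<^sub>m pure_state (epr_pairs k)"
      using final_states_zero[OF locc] by auto
    then show ?thesis by blast
  qed
qed

text \<open>Each measurement halves both dimensions, that is, uses up one pair, so \<open>r\<close>
  rounds lead from \<open>k + r\<close> pairs to \<open>k\<close>. The group is generalized because
  every round continues with the compressed one.\<close>

lemma purification_protocol_exists:
  assumes "error_group (2 ^ (k + r)) G" "S \<subseteq> G" "real (card S) \<le> capacity r"
  shows "\<exists>\<pi>. locc k \<pi> (2 ^ (k + r)) (2 ^ (k + r)) \<and> (\<forall>P\<in>S. recovers k \<pi> (k + r) P)"
  using assms
proof (induction r arbitrary: G S)
  case 0
  then interpret error_group "2 ^ k" G by simp
  have "card S \<le> 1" using 0(3) by (simp add: capacity_def)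
  moreover have "finite S" using 0(2) finite_G finite_subset by blast
  ultimately consider "S = {}" | P where "S = {P}"
    by (metis card_0_eq card_1_singletonE le_less less_one)
  then show ?case
  proof cases
    case 1
    then show ?thesis by (intro exI[of _ Output]) simp
  next
    case (2 P)
    then have "P \<in> G" using 0 by auto
    then show ?thesis
      using single_error_protocol[OF carrier unitary adjoint_mult] 2 by simp
  qed
next
  case (Suc r)
  interpret error_group "2 ^ (k + Suc r)" G by fact
  let ?n = "k + Suc r" and ?m = "k + r"
  obtain R where R: "R \<subseteq> S" "\<forall>P\<in>R. \<forall>Q\<in>R. P \<noteq> Q \<longrightarrow> (\<exists>A\<in>G. comm_sgn A P \<noteq> comm_sgn A Q)"
    "\<forall>P\<in>S. \<exists>Q\<in>R. \<exists>u. P = u \<cdot>\<^sub>m Q"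
    using representatives_exist[OF Suc.prems(2)] by (elim exE conjE)
  have "finite S" using Suc.prems(2) finite_G finite_subset by blast
  then have "card R \<le> card S" using R(1) by (rule card_mono)
  then have card_R: "real (card R) \<le> capacity (Suc r)" using Suc.prems(3) by linarith
  have RG: "R \<subseteq> G" using R(1) Suc.prems(2) by blast
  have "2 ^ ?n > (1 :: nat)" by (rule one_less_power) auto
  from balanced_measurement_exists[OF RG R(2) this card_R] obtain M B
    where M: "M \<in> G" "B \<in> G" "comm_sgn M B = - 1"
    and parts: "card {P \<in> R. comm_sgn M P = 1} \<le> capacity r" "card {P \<in> R. comm_sgn M P = - 1} \<le> capacity r"
    by (elim bexE conjE)
  have pow: "2 ^ ?n = 2 * 2 ^ ?m" by simp
  obtain N V a where NV: "N = a \<cdot>\<^sub>m M" "N * N = 1\<^sub>m (2 ^ ?n)" "V \<in> carrier_mat (2 ^ ?m) (2 ^ ?n)"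
    "V * mat_adjoint V = 1\<^sub>m (2 ^ ?m)" "mat_adjoint V * V = (1 / 2) \<cdot>\<^sub>m (1\<^sub>m (2 ^ ?n) + N)"
    using eigenprojection_factorization[OF M pow] .
  interpret measured_error_group "2 ^ ?n" G "2 ^ ?m" M N V B a
    by standard (fact M pow NV)+
  define R' where "R' s = {P \<in> R. comm_sgn M P = (if s then 1 else - 1)}" for s
  have "\<exists>\<pi>. locc k \<pi> (2 ^ ?m) (2 ^ ?m) \<and> (\<forall>Q\<in>residual ` R' s. recovers k \<pi> ?m Q)" for s
  proof (rule Suc.IH[OF error_group_compressed])
    show "residual ` R' s \<subseteq> compressed"
      using RG residual_in_compressed by (auto simp: R'_def)
    \<comment> \<open>Distinct errors may leave the same residual, which only reduces the number of
      candidates.\<close>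
    have "finite (R' s)" using finite_subset[OF RG finite_G] by (simp add: R'_def)
    then have "card (residual ` R' s) \<le> card (R' s)" by (rule card_image_le)
    moreover have "real (card (R' s)) \<le> capacity r" using parts by (simp add: R'_def)
    ultimately show "real (card (residual ` R' s)) \<le> capacity r" by linarith
  qed
  then have "\<exists>\<pi>. \<forall>s. locc k (\<pi> s) (2 ^ ?m) (2 ^ ?m) \<and> (\<forall>Q\<in>residual ` R' s. recovers k (\<pi> s) ?m Q)"
    by (intro choice allI)
  then obtain \<pi> where \<pi>: "\<And>s. locc k (\<pi> s) (2 ^ ?m) (2 ^ ?m)"
    "\<And>s Q. Q \<in> residual ` R' s \<Longrightarrow> recovers k (\<pi> s) ?m Q"
    by blast
  define \<pi>' where "\<pi>' = measure_pairs ?m eigenspace_map \<pi>"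
  have "locc k \<pi>' (2 ^ ?n) (2 ^ ?n)"
    unfolding \<pi>'_def by (intro locc_measure_pairs eigenspace_map_carrier eigenspace_map_complete \<pi>(1))
  moreover have "recovers k \<pi>' ?n P" if P: "P \<in> S" for P
  proof -
    obtain Q u where Q: "Q \<in> R" "P = u \<cdot>\<^sub>m Q" using R(3) P by blast
    have QG: "Q \<in> G" using Q(1) RG by blast
    define s where "s \<longleftrightarrow> comm_sgn M Q = 1"
    have "Q \<in> R' s" using Q(1) comm_sgn_cases[of M Q] by (auto simp: R'_def s_def)
    then have "recovers k (\<pi> s) ?m (residual Q)" using \<pi>(2) by blast
    moreover have "residual Q \<in> carrier_mat (2 ^ ?m) (2 ^ ?m)"
      by (simp add: residual_def carrier_matI)
    ultimately have "recovers k \<pi>' ?n Q"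
      unfolding \<pi>'_def
      using branch_error[OF QG] by (intro recovers_measure_pairs[OF eigenspace_map_carrier carrier[OF QG] _ _ \<pi>(1)]) (simp_all add: s_def)
    then show ?thesis unfolding Q(2) by (rule recovers_smult) (rule carrier[OF QG])
  qed
  ultimately show ?case by blast
qed

text \<open>Both parties discard their systems. What is left is a 1 by 1 matrix, which division by
  its nonzero trace turns into 1, the state of zero pairs.\<close>

lemma trivial_protocol_exists: "\<exists>\<pi>. two_way_epp n 0 \<pi> \<and> corrects n 0 \<pi> E"
proof -
  \<comment> \<open>The rows of the identity are Kraus operators of the trace map; they are grouped
    into one outcome below, so nothing is announced.\<close>
  define Ks :: "complex mat list" where "Ks = map (\<lambda>x. mat 1 (2 ^ n) (\<lambda>(_, j). of_bool (j = x))) [0..<2 ^ n]"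
  define \<pi> where "\<pi> = AliceOp 1 [Ks] (\<lambda>_. BobOp 1 [Ks] (\<lambda>_. Output))"
  have Ks: "K \<in> carrier_mat 1 (2 ^ n)" if "K \<in> set Ks" for K
    using that by (auto simp: Ks_def)
  have KK: "mat_adjoint K * K \<in> carrier_mat (2 ^ n) (2 ^ n)" if "K \<in> set Ks" for K
    using Ks[OF that] by (intro mult_carrier_mat[of _ _ 1]) auto
  have "sum_mats (2 ^ n) (2 ^ n) (map (\<lambda>K. mat_adjoint K * K) Ks) = 1\<^sub>m (2 ^ n)"
  proof (rule eq_matI)
    fix i j assume "i < dim_row (1\<^sub>m (2 ^ n) :: complex mat)" "j < dim_col (1\<^sub>m (2 ^ n) :: complex mat)"
    then have ij: "i < 2 ^ n" "j < 2 ^ n" by auto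
    have "sum_mats (2 ^ n) (2 ^ n) (map (\<lambda>K. mat_adjoint K * K) Ks) $$ (i, j)
        = (\<Sum>A\<leftarrow>map (\<lambda>K. mat_adjoint K * K) Ks. A $$ (i, j))"
      using ij
    proof (intro sum_mats_index)
      fix A assume "A \<in> set (map (\<lambda>K. mat_adjoint K * K) Ks)"
      then show "A \<in> carrier_mat (2 ^ n) (2 ^ n)" unfolding set_map using KK by blast
    qed
    also have "\<dots> = (\<Sum>x = 0..<2 ^ n. of_bool (i = x) * of_bool (j = x))"
      using ij by (simp add: Ks_def o_def interv_sum_list_conv_sum_set_nat index_mat_mult del: index_mult_mat(1))
    also have "\<dots> = (\<Sum>x = 0..<2 ^ n. if x = i then of_bool (i = j) else 0)"
      by (intro sum.cong) auto
    finally show "sum_mats (2 ^ n) (2 ^ n) (map (\<lambda>K. mat_adjoint K * K) Ks) $$ (i, j) = 1\<^sub>m (2 ^ n) $$ (i, j)"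
      using ij by simp
  next
    have "sum_mats (2 ^ n) (2 ^ n) (map (\<lambda>K. mat_adjoint K * K) Ks) \<in> carrier_mat (2 ^ n) (2 ^ n)"
      by (intro sum_mats_carrier) (use KK in \<open>unfold set_map, blast\<close>)
    then show "dim_row (sum_mats (2 ^ n) (2 ^ n) (map (\<lambda>K. mat_adjoint K * K) Ks)) = dim_row (1\<^sub>m (2 ^ n) :: complex mat)"
      "dim_col (sum_mats (2 ^ n) (2 ^ n) (map (\<lambda>K. mat_adjoint K * K) Ks)) = dim_col (1\<^sub>m (2 ^ n) :: complex mat)"
      by auto
  qed
  then have "is_instrument (2 ^ n) 1 [Ks]" using Ks by (simp add: is_instrument_def)
  then have "two_way_epp n 0 \<pi>" by (simp add: two_way_epp_def \<pi>_def)
  moreover have "corrects n 0 \<pi> E"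
    unfolding corrects_def
  proof (intro ballI impI)
    fix P \<sigma> assume "\<sigma> \<in> final_states \<pi> (2 ^ n) (2 ^ n) (noisy_epr_pairs n P)" and tr: "trace_mat \<sigma> \<noteq> 0"
    then obtain \<rho> where "\<sigma> = sum_mats 1 1 (map (\<lambda>K. sandwich (kron (1\<^sub>m 1) K) \<rho>) Ks)"
      by (auto simp: \<pi>_def)
    moreover have "sandwich (kron (1\<^sub>m 1) K) \<rho> \<in> carrier_mat 1 1" if "K \<in> set Ks" for K
      using Ks[OF that] by (intro carrier_matI) auto
    ultimately have \<sigma>: "\<sigma> \<in> carrier_mat 1 1" by (auto intro!: sum_mats_carrier)
    then have "trace_mat \<sigma> = \<sigma> $$ (0, 0)" by (simp add: trace_mat_def)
    with \<sigma> tr show "(1 / trace_mat \<sigma>) \<cdot>\<^sub>m \<sigma> = pure_state (epr_pairs 0)"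
      by (intro eq_matI) (auto simp: pure_state_def epr_pairs_def)
  qed
  ultimately show ?thesis by blast
qed

theorem theorem2:
  fixes n :: nat and E :: "complex mat set"
  assumes "n \<ge> 1"
    and "E \<subseteq> pauli_group n"
    and "E \<noteq> {}"
  shows "\<exists>(k :: nat) \<pi>. two_way_epp n k \<pi> \<and> corrects n k \<pi> E \<and>
           real k \<ge> real n - log 2 (real (card E)) - 2"
proof -
  have "finite E" using assms(2) finite_pauli_group finite_subset by blast
  then have card_E: "card E > 0" using assms(3) by (simp add: card_gt_0_iff)
  \<comment> \<open>The floor gives \<open>card E < 2 ^ (t + 1)\<close>, for which
    \<open>t + 2\<close> measurements suffice. Since \<open>t\<close> is at most the logarithm, the
    remaining \<open>n - (t + 2)\<close> pairs meet the bound.\<close>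
  define t where "t = nat \<lfloor>log 2 (real (card E))\<rfloor>"
  have log_nonneg: "0 \<le> log 2 (real (card E))" using card_E by simp
  then have "real t = real_of_int \<lfloor>log 2 (real (card E))\<rfloor>" by (simp add: t_def)
  then have t: "real t \<le> log 2 (real (card E))" "log 2 (real (card E)) < real t + 1"
    using of_int_floor_le[of "log 2 (real (card E))"] real_of_int_floor_add_one_gt[of "log 2 (real (card E))"]
    by linarith+
  have "real (card E) < 2 powr (real t + 1)"
    using t(2) card_E by (simp add: log_less_iff)
  also have "2 powr (real t + 1) = 2 ^ (t + 1)"
    using powr_realpow[of 2 "t + 1"] by (simp add: add.commute)
  finally have "real (card E) < 2 ^ (t + 1)" .
  then have card_le: "real (card E) \<le> capacity (t + 2)"
    using capacity_ge[of "t + 1"] by simp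
  show ?thesis
  proof (cases "n \<le> t + 2")
    case True
    \<comment> \<open>With at most \<open>t + 2\<close> pairs the required lower bound on
      \<open>k\<close> is not positive.\<close>
    obtain \<pi> where "two_way_epp n 0 \<pi>" "corrects n 0 \<pi> E" using trivial_protocol_exists by blast
    moreover have "real 0 \<ge> real n - log 2 (real (card E)) - 2" using True t(1) by simp
    ultimately show ?thesis by blast
  next
    case False
    define k where "k = n - (t + 2)"
    have n: "n = k + (t + 2)" using False by (simp add: k_def)
    obtain G where G: "error_group (2 ^ n) G" "pauli_group n \<subseteq> G" using pauli_group_in_error_group by blast
    obtain \<pi> where \<pi>: "locc k \<pi> (2 ^ n) (2 ^ n)" "\<And>P. P \<in> E \<Longrightarrow> recovers k \<pi> n P"
      using purification_protocol_exists[of k "t + 2" G E] G assms(2) card_le unfolding n by blast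
    have "two_way_epp n k \<pi>" using \<pi>(1) by (simp add: two_way_epp_def)
    moreover have "corrects n k \<pi> E" using \<pi>(2) by (rule corrects_if_recovers)
    moreover have "real k \<ge> real n - log 2 (real (card E)) - 2" using n t(1) by simp
    ultimately show ?thesis by blast
  qed
qed

end
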